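(* Let $0<q\le\infty$ and $s\in\mathbb R$. (i) If $1\le p<2$ and $t>d/2$, then $d^n(I,b^{s+t}_{p,q},b^s_{2,2})\asymp n^{-t/d}$. (ii) If $2<p\le\infty$ and $t>0$, then $d^n(I,b^{s+t}_{p,q},b^s_{2,2})\asymp n^{-t/d}$. (iii) If $0<p<1$ and $t>d(1/p-1/2)$, then there are constants $c_1,c_2>0$ with $c_1n^{-t/d}\le d^n(I,b^{s+t}_{p,q},b^s_{2,2})\le c_2n^{-t/d-1+1/p}$ for all $n$.
   Context: Sequence spaces: $\nabla=(\nabla_j)_{j\ge0}$ finite subsets of $\{1,\dots,2^d-1\}\times\mathbb Z^d$ with $C_1\le2^{-jd}|\nabla_j|\le C_2$ for all $j\ge J$ (some $0<C_1\le C_2$, $J\in\mathbb N$); $b^s_{p,q}=b^s_{p,q}(\nabla)$ is the space of sequences $a=(a_{j,\lambda})$ with $\|a\|_{b^s_{p,q}}=\big(\sum_{j\ge0}2^{j(s+d(1/2-1/p))q}(\sum_{\lambda\in\nabla_j}|a_{j,\lambda}|^p)^{q/p}\big)^{1/q}<\infty$ (sup over $j$ if $q=\infty$). $I$ is the identity. Gelfand widths: $d^n(I,F,Y)=\inf_{L_1,\dots,L_n}\sup\{\|f\|_Y:\|f\|_F\le1,\ L_i(f)=0,\ i=1,\dots,n\}$ over continuous linear functionals $L_i$ on $F$. $\asymp$: two-sided bounds with constants independent of $n$. *)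

theory Defs
  imports "HOL-Analysis.Analysis"
begin

text \<open>Index sets: nabla j is a finite subset of {1..2^d-1} x Z^d, with Z^d rendered
  as integer lists of length d. Sequences are real-valued functions of (j, lambda);
  elements of the sequence spaces are required to vanish off nabla.\<close>

type_synonym idx = "nat \<times> int list"
type_synonym seqn = "nat \<Rightarrow> idx \<Rightarrow> real"

definition admissible_index :: "nat \<Rightarrow> (nat \<Rightarrow> idx set) \<Rightarrow> bool" where
  "admissible_index d Nb \<longleftrightarrow>
     (\<forall>j. finite (Nb j) \<and> Nb j \<subseteq> {1..2^d - 1} \<times> {k. length k = d}) \<and>
     (\<exists>C1 C2 (J::nat). 0 < C1 \<and> C1 \<le> C2 \<and>
        (\<forall>j\<ge>J. C1 \<le> 2 powr (- real (j * d)) * real (card (Nb j)) \<and>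
                2 powr (- real (j * d)) * real (card (Nb j)) \<le> C2))"

definition invp :: "ereal \<Rightarrow> real" where
  "invp p = (if p = \<infinity> then 0 else 1 / real_of_ereal p)"

definition lpn :: "ereal \<Rightarrow> idx set \<Rightarrow> (idx \<Rightarrow> real) \<Rightarrow> real" where
  "lpn p A f = (if p = \<infinity> then Max (insert 0 ((\<lambda>x. \<bar>f x\<bar>) ` A))
                else (\<Sum>x\<in>A. \<bar>f x\<bar> powr real_of_ereal p) powr (1 / real_of_ereal p))"

definition bnorm :: "nat \<Rightarrow> (nat \<Rightarrow> idx set) \<Rightarrow> real \<Rightarrow> ereal \<Rightarrow> ereal \<Rightarrow> seqn \<Rightarrow> ennreal" where
  "bnorm d Nb s p q a =
     (let w = (\<lambda>j::nat. 2 powr (real j * (s + real d * (1/2 - invp p))) * lpn p (Nb j) (a j))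
      in if q = \<infinity> then (SUP j. ennreal (w j))
         else (let S = (\<Sum>j. ennreal (w j powr real_of_ereal q))
               in if S = \<infinity> then \<infinity> else ennreal (enn2real S powr (1 / real_of_ereal q))))"

definition bspace :: "nat \<Rightarrow> (nat \<Rightarrow> idx set) \<Rightarrow> real \<Rightarrow> ereal \<Rightarrow> ereal \<Rightarrow> seqn set" where
  "bspace d Nb s p q = {a. (\<forall>j x. x \<notin> Nb j \<longrightarrow> a j x = 0) \<and> bnorm d Nb s p q a < \<infinity>}"

text \<open>Continuous linear functionals on b^s_{p,q} (continuity w.r.t. the quasi-norm topology,
  which is metrizable, hence sequential continuity).\<close>
definition cont_lin_functional ::
  "nat \<Rightarrow> (nat \<Rightarrow> idx set) \<Rightarrow> real \<Rightarrow> ereal \<Rightarrow> ereal \<Rightarrow> (seqn \<Rightarrow> real) \<Rightarrow> bool" where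
  "cont_lin_functional d Nb s p q L \<longleftrightarrow>
     (\<forall>a\<in>bspace d Nb s p q. \<forall>b\<in>bspace d Nb s p q. L (\<lambda>j x. a j x + b j x) = L a + L b) \<and>
     (\<forall>c. \<forall>a\<in>bspace d Nb s p q. L (\<lambda>j x. c * a j x) = c * L a) \<and>
     (\<forall>X a. (\<forall>k. X k \<in> bspace d Nb s p q) \<longrightarrow> a \<in> bspace d Nb s p q \<longrightarrow>
        ((\<lambda>k. bnorm d Nb s p q (\<lambda>j x. X k j x - a j x)) \<longlonglongrightarrow> 0) \<longrightarrow>
        ((\<lambda>k. L (X k)) \<longlonglongrightarrow> L a))"

definition gelfand_width ::
  "nat \<Rightarrow> (nat \<Rightarrow> idx set) \<Rightarrow> nat \<Rightarrow> real \<Rightarrow> ereal \<Rightarrow> ereal \<Rightarrow> real \<Rightarrow> ereal \<Rightarrow> ereal \<Rightarrow> ennreal" where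
  "gelfand_width d Nb n s1 p1 q1 s2 p2 q2 =
     (INF L \<in> {L :: nat \<Rightarrow> seqn \<Rightarrow> real. \<forall>i<n. cont_lin_functional d Nb s1 p1 q1 (L i)}.
        SUP a \<in> {a \<in> bspace d Nb s1 p1 q1. bnorm d Nb s1 p1 q1 a \<le> 1 \<and> (\<forall>i<n. L i a = 0)}.
          bnorm d Nb s2 p2 q2 a)"

end

theory Submission
  imports Defs
begin

text \<open>Upper bounds: all coordinates of the levels \<open>j < k\<close> are used as functionals, which costs about
  \<open>2\<^sup>k\<^sup>d\<close> of them. For \<open>p > 2\<close> the remaining levels are controlled by Hoelder's inequality alone.
  For \<open>p < 2\<close> the unit ball is first embedded levelwise into an \<open>l\<^sub>1\<close>-ball, and level \<open>k + i\<close> receives about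
  \<open>2\<^sup>k\<^sup>d 2\<^sup>-\<^sup>i\<^sup>\<epsilon>\<close> further functionals whose common kernel satisfies the Garnaev--Gluskin inequality
  \<open>|x|\<^sub>2\<^sup>2 \<le> C ln (80 N / m) / m |x|\<^sub>1\<^sup>2\<close>.

  That inequality is obtained from random sign matrices without nets. By the fourth moment, a random sign
  matrix with \<open>m\<close> rows maps a fixed vector \<open>z\<close> to one of squared norm at least \<open>m |z|\<^sub>2\<^sup>2 / 10\<close> except with
  exponentially small probability. A union bound over integer vectors with \<open>|z|\<^sub>1 \<le> s\<close>, weighted by \<open>\<theta>\<close> to the
  power \<open>|z|\<^sub>1\<close>, yields one matrix for all these \<open>z\<close>. Approximating a kernel vector
  by a sum of \<open>s\<close> signed unit vectors (Maurey's method) transfers the lower bound to the kernel.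

  Lower bounds: on one level with \<open>N \<ge> 2 n\<close> coordinates, a vertex of the section of the cube by the kernel of
  \<open>n\<close> functionals has at least \<open>N / 2\<close> coordinates \<open>1\<close> or \<open>-1\<close>. Its \<open>l\<^sub>2\<close>-norm is at least \<open>(N / 2)\<^sup>1\<^sup>/\<^sup>2\<close>
  and its \<open>l\<^sub>p\<close>-norm at most \<open>N\<^sup>1\<^sup>/\<^sup>p\<close>, for every \<open>p\<close>.\<close>

subsection \<open>Random sign patterns\<close>

text \<open>A sign vector on \<open>I\<close> is encoded by the set \<open>T\<close> of its plus
  signs, so that averages over random signs become finite sums over \<open>Pow I\<close>.\<close>

definition signed_sum :: "'a set \<Rightarrow> 'a set \<Rightarrow> ('a \<Rightarrow> real) \<Rightarrow> real" where
  "signed_sum I T x = (\<Sum>i\<in>I. (if i \<in> T then 1 else - 1) * x i)"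

lemma sum_Pow_insert:
  assumes "finite F" "a \<notin> F"
  shows "(\<Sum>T\<in>Pow (insert a F). f T) = (\<Sum>T\<in>Pow F. f T + f (insert a T) :: real)"
proof -
  have "inj_on (insert a) (Pow F)"
    using assms by (auto simp: inj_on_def)
  moreover have "Pow F \<inter> insert a ` Pow F = {}"
    using assms by auto
  ultimately show ?thesis
    using assms by (simp add: Pow_insert sum.union_disjoint sum.reindex sum.distrib)
qed

lemma signed_sum_insert:
  assumes "finite F" "a \<notin> F" "T \<subseteq> F"
  shows "signed_sum (insert a F) T x = signed_sum F T x - x a"
    and "signed_sum (insert a F) (insert a T) x = signed_sum F T x + x a"
proof -
  show "signed_sum (insert a F) T x = signed_sum F T x - x a"
    using assms by (auto simp: signed_sum_def)
  have "(\<Sum>i\<in>F. (if i \<in> insert a T then 1 else - 1) * x i) = (\<Sum>i\<in>F. (if i \<in> T then 1 else - 1) * x i)"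
    using assms by (intro sum.cong) auto
  then show "signed_sum (insert a F) (insert a T) x = signed_sum F T x + x a"
    using assms by (simp add: signed_sum_def)
qed

lemma sum_signed_sum_square:
  assumes "finite I"
  shows "(\<Sum>T\<in>Pow I. (signed_sum I T x)\<^sup>2) = 2 ^ card I * (\<Sum>i\<in>I. (x i)\<^sup>2)"
  using assms
proof (induction I rule: finite_induct)
  case empty
  then show ?case by (simp add: signed_sum_def)
next
  case (insert a F)
  have "(\<Sum>T\<in>Pow (insert a F). (signed_sum (insert a F) T x)\<^sup>2)
      = (\<Sum>T\<in>Pow F. 2 * (signed_sum F T x)\<^sup>2 + 2 * (x a)\<^sup>2)"
    unfolding sum_Pow_insert[OF insert(1,2)]
    by (intro sum.cong refl) (use insert in \<open>auto simp: signed_sum_insert power2_eq_square algebra_simps\<close>)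
  also have "\<dots> = 2 ^ card (insert a F) * (\<Sum>i\<in>insert a F. (x i)\<^sup>2)"
    using insert by (simp add: sum.distrib sum_distrib_left[symmetric] card_Pow algebra_simps)
  finally show ?case .
qed

lemma sum_signed_sum_fourth_power_le:
  assumes "finite I"
  shows "(\<Sum>T\<in>Pow I. (signed_sum I T x) ^ 4) \<le> 3 * 2 ^ card I * (\<Sum>i\<in>I. (x i)\<^sup>2)\<^sup>2"
  using assms
proof (induction I rule: finite_induct)
  case empty
  then show ?case by (simp add: signed_sum_def)
next
  case (insert a F)
  define v where "v = (\<Sum>i\<in>F. (x i)\<^sup>2)"
  have "(\<Sum>T\<in>Pow (insert a F). (signed_sum (insert a F) T x) ^ 4)
      = (\<Sum>T\<in>Pow F. 2 * (signed_sum F T x) ^ 4 + 12 * (x a)\<^sup>2 * (signed_sum F T x)\<^sup>2 + 2 * (x a) ^ 4)"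
    unfolding sum_Pow_insert[OF insert(1,2)]
    by (intro sum.cong refl)
      (use insert in \<open>auto simp: signed_sum_insert power2_eq_square power4_eq_xxxx algebra_simps\<close>)
  also have "\<dots> = 2 * (\<Sum>T\<in>Pow F. (signed_sum F T x) ^ 4) + 12 * (x a)\<^sup>2 * (2 ^ card F * v) + 2 * 2 ^ card F * (x a) ^ 4"
    using insert by (simp add: sum.distrib sum_distrib_left[symmetric] card_Pow sum_signed_sum_square v_def)
  \<comment> \<open>The cross coefficient 12 dictates the constant 3; raising the last coefficient
    from 2 to 6 then completes the square.\<close>
  also have "\<dots> \<le> 2 * (3 * 2 ^ card F * v\<^sup>2) + 12 * (x a)\<^sup>2 * (2 ^ card F * v) + 6 * 2 ^ card F * (x a) ^ 4"
  proof -
    have "0 \<le> 2 ^ card F * (x a) ^ 4"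
      by simp
    then show ?thesis
      using insert.IH unfolding v_def by linarith
  qed
  also have "\<dots> = 3 * 2 ^ card (insert a F) * ((x a)\<^sup>2 + v)\<^sup>2"
    using insert by (simp add: power2_eq_square power4_eq_xxxx algebra_simps)
  finally show ?case
    using insert by (simp add: v_def)
qed

section \<open>Laplace transform of the squared signed sum\<close>

lemma exp_minus_le_quadratic:
  fixes u :: real
  assumes "0 \<le> u"
  shows "exp (- u) \<le> 1 - u + u\<^sup>2 / 2"
proof -
  define g where "g = (\<lambda>u::real. 1 - u + u\<^sup>2 / 2 - exp (- u))"
  have "g 0 \<le> g u"
  proof (rule DERIV_nonneg_imp_nondecreasing[OF assms])
    fix v :: real
    have "(g has_real_derivative (v - 1 + exp (- v))) (at v)"
      unfolding g_def by (auto intro!: derivative_eq_intros)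
    moreover have "0 \<le> v - 1 + exp (- v)"
      using exp_ge_add_one_self[of "- v"] by simp
    ultimately show "\<exists>y. (g has_real_derivative y) (at v) \<and> 0 \<le> y"
      by blast
  qed
  then show ?thesis
    by (simp add: g_def)
qed

text \<open>With \<open>u\<close> the squared signed sum divided by three times its mean, the
  quadratic bound for \<open>exp (- u)\<close> involves only the second and fourth moments and
  averages to at most 1 - 1/3 + 1/6. The factor three minimises this value.\<close>

lemma sum_exp_signed_sum_le:
  assumes "finite I" and pos: "0 < (\<Sum>i\<in>I. (x i)\<^sup>2)"
  shows "(\<Sum>T\<in>Pow I. exp (- (signed_sum I T x)\<^sup>2 / (3 * (\<Sum>i\<in>I. (x i)\<^sup>2)))) \<le> 2 ^ card I * (5 / 6)"
proof -
  define v where "v = (\<Sum>i\<in>I. (x i)\<^sup>2)"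
  have v: "0 < v"
    using pos by (simp add: v_def)
  have "(\<Sum>T\<in>Pow I. exp (- (signed_sum I T x)\<^sup>2 / (3 * v)))
      \<le> (\<Sum>T\<in>Pow I. 1 - (signed_sum I T x)\<^sup>2 / (3 * v) + (signed_sum I T x) ^ 4 / (18 * v\<^sup>2))"
  proof (rule sum_mono)
    fix T
    have "exp (- ((signed_sum I T x)\<^sup>2 / (3 * v)))
        \<le> 1 - (signed_sum I T x)\<^sup>2 / (3 * v) + ((signed_sum I T x)\<^sup>2 / (3 * v))\<^sup>2 / 2"
      using v by (intro exp_minus_le_quadratic) simp
    then show "exp (- (signed_sum I T x)\<^sup>2 / (3 * v))
        \<le> 1 - (signed_sum I T x)\<^sup>2 / (3 * v) + (signed_sum I T x) ^ 4 / (18 * v\<^sup>2)"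
      by (simp add: power_divide power_mult_distrib flip: power_mult)
  qed
  also have "\<dots> = 2 ^ card I - (\<Sum>T\<in>Pow I. (signed_sum I T x)\<^sup>2) / (3 * v)
      + (\<Sum>T\<in>Pow I. (signed_sum I T x) ^ 4) / (18 * v\<^sup>2)"
    using assms by (simp add: sum.distrib sum_subtractf card_Pow flip: sum_divide_distrib)
  also have "\<dots> \<le> 2 ^ card I - (2 ^ card I * v) / (3 * v) + (3 * 2 ^ card I * v\<^sup>2) / (18 * v\<^sup>2)"
    using sum_signed_sum_square[OF assms(1), of x] sum_signed_sum_fourth_power_le[OF assms(1), of x]
    by (intro add_mono diff_mono divide_right_mono) (auto simp: v_def intro: sum_nonneg)
  also have "\<dots> = 2 ^ card I * (5 / 6)"
    using v by simp
  finally show ?thesis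
    by (simp add: v_def)
qed

section \<open>One sign matrix for all short integer vectors\<close>

lemma sum_power_nat_abs_le:
  fixes \<theta> :: real
  assumes "0 \<le> \<theta>" "\<theta> \<le> 1 / 2"
  shows "(\<Sum>k\<in>{- int s..int s}. \<theta> ^ nat \<bar>k\<bar>) \<le> exp (4 * \<theta>)"
proof -
  have eq: "(\<Sum>k\<in>{- int s..int s}. \<theta> ^ nat \<bar>k\<bar>) * (1 - \<theta>) = 1 + \<theta> - 2 * \<theta> ^ Suc s"
  proof (induction s)
    case 0
    then show ?case by simp
  next
    case (Suc s)
    have "{- int (Suc s)..int (Suc s)} = insert (- int (Suc s)) (insert (int (Suc s)) {- int s..int s})"
      by auto
    then have "(\<Sum>k\<in>{- int (Suc s)..int (Suc s)}. \<theta> ^ nat \<bar>k\<bar>)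
        = 2 * \<theta> ^ Suc s + (\<Sum>k\<in>{- int s..int s}. \<theta> ^ nat \<bar>k\<bar>)"
      by (simp del: of_nat_Suc power_Suc)
    then have "(\<Sum>k\<in>{- int (Suc s)..int (Suc s)}. \<theta> ^ nat \<bar>k\<bar>) * (1 - \<theta>)
        = 2 * \<theta> ^ Suc s * (1 - \<theta>) + (\<Sum>k\<in>{- int s..int s}. \<theta> ^ nat \<bar>k\<bar>) * (1 - \<theta>)"
      by (simp only: distrib_right)
    also have "\<dots> = 1 + \<theta> - 2 * \<theta> ^ Suc (Suc s)"
      unfolding Suc by (simp add: algebra_simps)
    finally show ?case .
  qed
  \<comment> \<open>After expansion this reads
    \<open>4 * \<theta>\<^sup>2 \<le> 2 * \<theta>\<close>, which is where
    \<open>\<theta> \<le> 1 / 2\<close> enters.\<close>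
  have "1 + \<theta> \<le> (1 + 4 * \<theta>) * (1 - \<theta>)"
    using assms mult_left_mono[of "2 * \<theta>" 1 \<theta>] by (simp add: algebra_simps)
  then have "(\<Sum>k\<in>{- int s..int s}. \<theta> ^ nat \<bar>k\<bar>) * (1 - \<theta>) \<le> (1 + 4 * \<theta>) * (1 - \<theta>)"
    using assms eq zero_le_power[of \<theta> "Suc s"] by linarith
  then have "(\<Sum>k\<in>{- int s..int s}. \<theta> ^ nat \<bar>k\<bar>) \<le> 1 + 4 * \<theta>"
    using assms by (simp add: mult_le_cancel_right)
  then show ?thesis
    using exp_ge_add_one_self[of "4 * \<theta>"] by linarith
qed

text \<open>The margin per row in the union bound: the Laplace factor 5/6 has to outweigh
  \<open>exp (1 / 20)\<close> for the total weight, \<open>exp (1 / 20)\<close> for the weight of a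
  single vector and \<open>exp (1 / 30)\<close> for the threshold.\<close>

lemma exp_times_five_sixths_le: "exp (1 / 30 :: real) * (5 / 6) \<le> exp (- 1 / 10)"
proof -
  have "(2 / 15 :: real) \<le> 1" by simp
  then have "exp (2 / 15 :: real) \<le> 1 + 2 / 15 + (2 / 15)\<^sup>2"
    by (intro exp_bound) auto
  also have "\<dots> \<le> 6 / 5"
    by (simp add: power2_eq_square)
  finally have "exp (2 / 15 :: real) * (5 / 6) \<le> 1"
    by simp
  have "exp (1 / 30 :: real) = exp (- 1 / 10) * exp (2 / 15)"
    by (simp flip: exp_add)
  then have "exp (1 / 30 :: real) * (5 / 6) = exp (- 1 / 10) * (exp (2 / 15) * (5 / 6))"
    by simp
  also have "\<dots> \<le> exp (- 1 / 10) * 1"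
    using \<open>exp (2 / 15 :: real) * (5 / 6) \<le> 1\<close> by (intro mult_left_mono) auto
  finally show ?thesis
    by simp
qed

text \<open>First moment method: the weighted sum of \<open>E A z\<close> over all \<open>z\<close>
  has a small mean over random matrices \<open>A\<close>, so it is small for some \<open>A\<close>.
  For this \<open>A\<close> each single term is small, and since \<open>W z\<close> is not too
  small, \<open>E A z\<close> must be; this forces the image of \<open>z\<close> to be long.\<close>

lemma exists_sign_patterns:
  fixes I :: "'a set" and K :: real
  assumes I: "finite I" "real (card I) \<le> K" and m: "1 \<le> m" "real m \<le> K"
    and s: "real s * ln (80 * K / real m) \<le> real m / 20"
  shows "\<exists>A :: nat \<Rightarrow> 'a set. \<forall>z :: 'a \<Rightarrow> int. (\<Sum>i\<in>I. \<bar>z i\<bar>) \<le> int s \<longrightarrow>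
     real m / 10 * (\<Sum>i\<in>I. (real_of_int (z i))\<^sup>2) \<le> (\<Sum>r<m. (signed_sum I (A r) (\<lambda>i. real_of_int (z i)))\<^sup>2)"
proof -
  \<comment> \<open>This value makes the total weight at most
    \<open>exp (4 * \<theta> * K) = exp (m / 20)\<close>, while the hypothesis on \<open>s\<close>
    says precisely that \<open>\<theta> ^ s\<close> is at least
    \<open>exp (- m / 20)\<close>.\<close>
  define \<theta> where "\<theta> = real m / (80 * K)"
  have K: "0 < K" using m by linarith
  have \<theta>: "0 < \<theta>" "\<theta> \<le> 1 / 2"
    using m K by (auto simp: \<theta>_def field_simps)
  \<comment> \<open>The rows are independent choices of a subset of \<open>I\<close>, so sums over
    \<open>M\<close> of products over the rows factor.\<close>
  define M where "M = (PiE {..<m} (\<lambda>_. Pow I))"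
  define V where "V = (\<lambda>z :: 'a \<Rightarrow> int. \<Sum>i\<in>I. (real_of_int (z i))\<^sup>2)"
  define Z where "Z = {z \<in> PiE I (\<lambda>_. {- int s..int s}). 0 < V z}"
  define E where "E = (\<lambda>A z. \<Prod>r<m. exp (- (signed_sum I (A r) (\<lambda>i. real_of_int (z i)))\<^sup>2 / (3 * V z)))"
  define W where "W = (\<lambda>z :: 'a \<Rightarrow> int. \<Prod>i\<in>I. \<theta> ^ nat \<bar>z i\<bar>)"
  have finP: "finite (PiE I (\<lambda>_. {- int s..int s}))"
    using I by (intro finite_PiE) auto
  then have finZ: "finite Z"
    by (auto simp: Z_def)
  have finM: "finite M"
    unfolding M_def using I by (intro finite_PiE) auto
  have cardM: "real (card M) = (2 ^ card I) ^ m"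
    using I by (simp add: M_def card_PiE card_Pow)
  have W0: "0 \<le> W z" for z
    using \<theta> by (auto simp: W_def intro!: prod_nonneg)
  have E0: "0 \<le> E A z" for A z
    by (auto simp: E_def intro!: prod_nonneg)
  have sumE: "(\<Sum>A\<in>M. E A z) \<le> (2 ^ card I * (5 / 6)) ^ m" if "z \<in> Z" for z
  proof -
    have "(\<Sum>A\<in>M. E A z) = (\<Prod>r<m. \<Sum>T\<in>Pow I. exp (- (signed_sum I T (\<lambda>i. real_of_int (z i)))\<^sup>2 / (3 * V z)))"
      unfolding M_def E_def using I by (subst prod_sum_PiE) auto
    also have "\<dots> \<le> (\<Prod>r<m. 2 ^ card I * (5 / 6))"
      using sum_exp_signed_sum_le[OF I(1), of "\<lambda>i. real_of_int (z i)"] that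
      by (intro prod_mono conjI sum_nonneg) (auto simp: Z_def V_def)
    finally show ?thesis by simp
  qed
  have sumW: "(\<Sum>z\<in>Z. W z) \<le> exp (real m / 20)"
  proof -
    have "(\<Sum>z\<in>Z. W z) \<le> (\<Sum>z\<in>PiE I (\<lambda>_. {- int s..int s}). W z)"
      using finP W0 by (intro sum_mono2) (auto simp: Z_def)
    also have "\<dots> = (\<Prod>i\<in>I. \<Sum>k\<in>{- int s..int s}. \<theta> ^ nat \<bar>k\<bar>)"
      unfolding W_def using I by (subst prod_sum_PiE) auto
    also have "\<dots> \<le> (\<Prod>i\<in>I. exp (4 * \<theta>))"
      using \<theta> sum_power_nat_abs_le[of \<theta> s] by (intro prod_mono conjI sum_nonneg) auto
    also have "\<dots> = exp (4 * \<theta> * real (card I))"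
      by (simp add: exp_of_nat_mult[symmetric] mult.commute)
    also have "\<dots> \<le> exp (4 * \<theta> * K)"
      using I \<theta> by (simp add: mult_left_mono)
    also have "\<dots> = exp (real m / 20)"
      using K by (simp add: \<theta>_def)
    finally show ?thesis .
  qed
  \<comment> \<open>The mean over \<open>M\<close> obeys this bound, hence not every matrix can
    exceed it.\<close>
  have "\<exists>A\<in>M. (\<Sum>z\<in>Z. W z * E A z) \<le> (5 / 6) ^ m * exp (real m / 20)"
  proof (rule ccontr)
    assume "\<not> ?thesis"
    then have less: "(5 / 6) ^ m * exp (real m / 20) < (\<Sum>z\<in>Z. W z * E A z)" if "A \<in> M" for A
      using that by force
    have "M \<noteq> {}"
      by (auto simp: M_def PiE_eq_empty_iff)
    then have "(\<Sum>A\<in>M. (5 / 6) ^ m * exp (real m / 20)) < (\<Sum>A\<in>M. \<Sum>z\<in>Z. W z * E A z)"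
      using finM less by (intro sum_strict_mono) auto
    also have "\<dots> = (\<Sum>z\<in>Z. W z * (\<Sum>A\<in>M. E A z))"
      by (subst sum.swap) (simp add: sum_distrib_left)
    also have "\<dots> \<le> (\<Sum>z\<in>Z. W z * (2 ^ card I * (5 / 6)) ^ m)"
      using sumE W0 by (intro sum_mono mult_left_mono) auto
    also have "\<dots> \<le> exp (real m / 20) * (2 ^ card I * (5 / 6)) ^ m"
      using sumW by (simp flip: sum_distrib_right)
    also have "\<dots> = (\<Sum>A\<in>M. (5 / 6) ^ m * exp (real m / 20))"
      by (simp only: sum_constant cardM power_mult_distrib mult_ac)
    finally show False
      by simp
  qed
  then obtain A where A: "A \<in> M" "(\<Sum>z\<in>Z. W z * E A z) \<le> (5 / 6) ^ m * exp (real m / 20)"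
    by blast
  show ?thesis
  proof (intro exI[of _ A] allI impI)
    fix z0 :: "'a \<Rightarrow> int"
    assume z0: "(\<Sum>i\<in>I. \<bar>z0 i\<bar>) \<le> int s"
    \<comment> \<open>Values off \<open>I\<close> do not affect the claim; restricting makes
      \<open>z\<close> a member of the extensional function space summed over.\<close>
    define z where "z = restrict z0 I"
    have zI: "z i = z0 i" if "i \<in> I" for i
      using that by (simp add: z_def)
    have sz: "(\<Sum>i\<in>I. \<bar>z i\<bar>) \<le> int s"
      using z0 zI by simp
    have le: "\<bar>z i\<bar> \<le> int s" if "i \<in> I" for i
      using member_le_sum[of i I "\<lambda>i. \<bar>z i\<bar>"] that I sz by auto
    have ss: "signed_sum I T (\<lambda>i. real_of_int (z0 i)) = signed_sum I T (\<lambda>i. real_of_int (z i))" for T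
      using zI by (simp add: signed_sum_def)
    have V: "(\<Sum>i\<in>I. (real_of_int (z0 i))\<^sup>2) = V z"
      using zI by (simp add: V_def)
    define Q where "Q = (\<Sum>r<m. (signed_sum I (A r) (\<lambda>i. real_of_int (z i)))\<^sup>2)"
    have "real m / 10 * V z \<le> Q"
    proof (cases "0 < V z")
      case False
      moreover have "0 \<le> V z" "0 \<le> Q"
        by (auto simp: V_def Q_def intro!: sum_nonneg)
      ultimately have "V z = 0" by simp
      then show ?thesis
        using \<open>0 \<le> Q\<close> by simp
    next
      case True
      have "z \<in> PiE I (\<lambda>_. {- int s..int s})"
        using le by (fastforce simp: z_def)
      then have zZ: "z \<in> Z"
        using True by (simp add: Z_def)
      have "W z = \<theta> ^ (\<Sum>i\<in>I. nat \<bar>z i\<bar>)"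
        by (simp add: W_def power_sum)
      moreover have "(\<Sum>i\<in>I. nat \<bar>z i\<bar>) \<le> s"
      proof -
        have "int (\<Sum>i\<in>I. nat \<bar>z i\<bar>) = (\<Sum>i\<in>I. \<bar>z i\<bar>)"
          by simp
        then show ?thesis
          using sz by linarith
      qed
      ultimately have Wz: "\<theta> ^ s \<le> W z"
        using \<theta> by (simp add: power_decreasing)
      have Ez: "E A z = exp (- Q / (3 * V z))"
        by (simp add: E_def Q_def sum_divide_distrib sum_negf flip: exp_sum)
      have "\<theta> ^ s * exp (- Q / (3 * V z)) \<le> W z * E A z"
        unfolding Ez using Wz by (intro mult_right_mono) auto
      also have "\<dots> \<le> (\<Sum>z\<in>Z. W z * E A z)"
        using zZ finZ W0 E0 by (intro member_le_sum) auto
      also have "\<dots> \<le> (5 / 6) ^ m * exp (real m / 20)"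
        by (rule A)
      finally have 1: "\<theta> ^ s * exp (- Q / (3 * V z)) \<le> (5 / 6) ^ m * exp (real m / 20)" .
      have ln\<theta>: "ln \<theta> = - ln (80 * K / real m)"
        using K m by (simp add: \<theta>_def ln_div)
      have "\<theta> ^ s = exp (real s * ln \<theta>)"
        using \<theta> by (simp add: exp_of_nat_mult)
      then have "exp (- (real m / 20)) \<le> \<theta> ^ s"
        using s by (simp add: ln\<theta>)
      then have "exp (- (real m / 20)) * exp (- Q / (3 * V z)) \<le> \<theta> ^ s * exp (- Q / (3 * V z))"
        by (intro mult_right_mono) auto
      then have "exp (- (real m / 20)) * exp (- Q / (3 * V z)) \<le> (5 / 6) ^ m * exp (real m / 20)"
        using 1 by linarith
      \<comment> \<open>This factor leaves \<open>exp (m / 30 - Q / (3 * V z))\<close> on the left;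
        the margin per row bounds the right-hand side by 1.\<close>
      then have "exp (real m / 30) * exp (real m / 20) * (exp (- (real m / 20)) * exp (- Q / (3 * V z)))
          \<le> exp (real m / 30) * exp (real m / 20) * ((5 / 6) ^ m * exp (real m / 20))"
        by (intro mult_left_mono) auto
      moreover have "exp (real m / 30) * exp (real m / 20) * (exp (- (real m / 20)) * exp (- Q / (3 * V z)))
          = exp (real m / 30) * exp (- Q / (3 * V z))"
        by (simp add: exp_minus)
      moreover have "exp (real m / 30) * exp (real m / 20) * ((5 / 6) ^ m * exp (real m / 20))
          = exp (real m / 10) * (exp (1 / 30) * (5 / 6)) ^ m"
      proof -
        have e: "(exp (1 / 30) :: real) ^ m = exp (real m / 30)"
            "exp (real m / 10) = exp (real m / 20) * exp (real m / 20)"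
          by (simp_all flip: exp_of_nat_mult exp_add)
        then show ?thesis
          unfolding power_mult_distrib e by (simp only: mult_ac)
      qed
      moreover have "(exp (1 / 30) * (5 / 6)) ^ m \<le> exp (- 1 / 10 :: real) ^ m"
        by (intro power_mono exp_times_five_sixths_le) auto
      moreover have "exp (- 1 / 10 :: real) ^ m = exp (- (real m / 10))"
        by (simp flip: exp_of_nat_mult)
      ultimately have "exp (real m / 30) * exp (- Q / (3 * V z)) \<le> exp (real m / 10) * exp (- (real m / 10))"
        by (smt (verit) exp_gt_zero mult_left_mono)
      then have "exp (real m / 30 - Q / (3 * V z)) \<le> exp 0"
        by (simp flip: exp_add)
      then have "real m / 30 \<le> Q / (3 * V z)"
        by simp
      then show ?thesis
        using True by (simp add: field_simps)
    qed
    then show "real m / 10 * (\<Sum>i\<in>I. (real_of_int (z0 i))\<^sup>2)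
        \<le> (\<Sum>r<m. (signed_sum I (A r) (\<lambda>i. real_of_int (z0 i)))\<^sup>2)"
      by (simp add: ss V Q_def)
  qed
qed

subsection \<open>The Garnaev--Gluskin inequality\<close>

lemma exists_le_weighted_sum:
  fixes w g :: "'a \<Rightarrow> real"
  assumes "finite I" "\<And>i. i \<in> I \<Longrightarrow> 0 \<le> w i" "(\<Sum>i\<in>I. w i) = 1"
  shows "\<exists>i\<in>I. g i \<le> (\<Sum>i\<in>I. w i * g i)"
proof (rule ccontr)
  assume neg: "\<not> ?thesis"
  define S where "S = (\<Sum>i\<in>I. w i * g i)"
  have less: "S < g i" if "i \<in> I" for i
    using neg that by (auto simp: S_def not_le)
  obtain i where i: "i \<in> I" "w i \<noteq> 0"
    using assms(3) by (metis sum.neutral zero_neq_one)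
  have "(\<Sum>i\<in>I. w i * S) < (\<Sum>i\<in>I. w i * g i)"
  proof (rule sum_strict_mono_ex1)
    show "\<forall>i\<in>I. w i * S \<le> w i * g i"
      using assms(2) less by (meson less_imp_le mult_left_mono)
    show "\<exists>i\<in>I. w i * S < w i * g i"
    proof (intro bexI mult_strict_left_mono)
      show "0 < w i"
        using i assms(2)[OF i(1)] by linarith
    qed (use i less in auto)
  qed (rule assms)
  then show False
    using assms(3) by (simp add: S_def flip: sum_distrib_right)
qed

text \<open>Maurey's empirical method, derandomised greedily: the bound is the expectation of the left-hand side
  when \<open>z - u\<close> is the sum of \<open>k\<close> independent signed unit vectors with mean \<open>y\<close>.\<close>

lemma maurey_sampling:
  fixes e :: "nat \<Rightarrow> 'a \<Rightarrow> real" and y :: "'a \<Rightarrow> real" and u :: "'a \<Rightarrow> int" and \<beta> :: real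
  assumes I: "finite I" and e: "\<And>r i. (e r i)\<^sup>2 = 1"
    and y: "(\<Sum>i\<in>I. \<bar>y i\<bar>) = 1" and ker: "\<And>r. r < m \<Longrightarrow> (\<Sum>i\<in>I. e r i * y i) = 0"
  shows "\<exists>z :: 'a \<Rightarrow> int. (\<Sum>i\<in>I. \<bar>z i - u i\<bar>) \<le> int k \<and>
    (\<Sum>r<m. (\<Sum>i\<in>I. e r i * z i)\<^sup>2) - \<beta> * (\<Sum>i\<in>I. (real_of_int (z i))\<^sup>2)
    \<le> (\<Sum>r<m. (\<Sum>i\<in>I. e r i * u i)\<^sup>2) - \<beta> * (\<Sum>i\<in>I. (real_of_int (u i))\<^sup>2) + k * m
      - \<beta> * (2 * k * (\<Sum>i\<in>I. u i * y i) + k * (real k - 1) * (\<Sum>i\<in>I. (y i)\<^sup>2) + k)"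
proof (induction k arbitrary: u)
  case 0
  show ?case by (intro exI[of _ u]) simp
next
  case (Suc k)
  \<comment> \<open>Drawing the index \<open>i\<close> with probability
    \<open>\<bar>y i\<bar>\<close> and adding \<open>\<sigma> i\<close> to coordinate
    \<open>i\<close> moves \<open>u\<close> by a signed unit vector whose mean is
    \<open>y\<close>.\<close>
  define \<sigma> :: "'a \<Rightarrow> int" where "\<sigma> = (\<lambda>i. if 0 \<le> y i then 1 else - 1)"
  have \<sigma>: "\<bar>y i\<bar> * \<sigma> i = y i" "(real_of_int (\<sigma> i))\<^sup>2 = 1" "\<bar>\<sigma> i\<bar> = 1" "\<sigma> i * y i = \<bar>y i\<bar>" for i
    by (auto simp: \<sigma>_def)
  define v where "v = (\<lambda>i. u(i := u i + \<sigma> i))"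
  define \<psi> where "\<psi> = (\<lambda>u :: 'a \<Rightarrow> int. (\<Sum>r<m. (\<Sum>i\<in>I. e r i * u i)\<^sup>2) - \<beta> * (\<Sum>i\<in>I. (real_of_int (u i))\<^sup>2))"
  define Y where "Y = (\<Sum>i\<in>I. (y i)\<^sup>2)"
  \<comment> \<open>The claimed bound as a function of the current point and the number of remaining
    steps. It is preserved on average by one step, so some choice of \<open>i\<close> does not
    increase it.\<close>
  define \<phi> where "\<phi> = (\<lambda>(u :: 'a \<Rightarrow> int) k :: nat. \<psi> u + k * m
      - \<beta> * (2 * k * (\<Sum>i\<in>I. u i * y i) + k * (real k - 1) * Y + k))"
  have upd: "(\<Sum>j\<in>I. h j (v i j)) = (\<Sum>j\<in>I. h j (u j)) + (h i (u i + \<sigma> i) - h i (u i))"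
    if "i \<in> I" for i and h :: "'a \<Rightarrow> int \<Rightarrow> real"
  proof -
    have "(\<Sum>j\<in>I. h j (v i j)) = h i (v i i) + (\<Sum>j\<in>I - {i}. h j (v i j))"
      using I that by (simp add: sum.remove)
    also have "(\<Sum>j\<in>I - {i}. h j (v i j)) = (\<Sum>j\<in>I - {i}. h j (u j))"
      by (intro sum.cong) (auto simp: v_def)
    also have "\<dots> = (\<Sum>j\<in>I. h j (u j)) - h i (u i)"
      using I that by (simp add: sum.remove)
    finally show ?thesis
      by (simp add: v_def)
  qed
  have inner: "(\<Sum>j\<in>I. v i j * y j) = (\<Sum>j\<in>I. u j * y j) + \<bar>y i\<bar>" if "i \<in> I" for i
    using upd[OF that, of "\<lambda>j a. a * y j"] \<sigma>(4)[of i] by (simp add: algebra_simps)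
  have square: "(\<Sum>j\<in>I. (real_of_int (v i j))\<^sup>2) = (\<Sum>j\<in>I. (real_of_int (u j))\<^sup>2) + 2 * u i * \<sigma> i + 1" if "i \<in> I" for i
    using upd[OF that, of "\<lambda>j a. (real_of_int a)\<^sup>2"] \<sigma>(2)[of i] by (simp add: power2_sum)
  have row: "(\<Sum>j\<in>I. e r j * v i j)\<^sup>2 = (\<Sum>j\<in>I. e r j * u j)\<^sup>2 + 2 * (\<Sum>j\<in>I. e r j * u j) * (e r i * \<sigma> i) + 1"
    if "i \<in> I" for r i
  proof -
    have "(\<Sum>j\<in>I. e r j * v i j) = (\<Sum>j\<in>I. e r j * u j) + e r i * \<sigma> i"
      using upd[OF that, of "\<lambda>j a. e r j * a"] by (simp add: algebra_simps)
    then show ?thesis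
      using e[of r i] \<sigma>(2)[of i] by (simp add: power2_sum power_mult_distrib)
  qed
  define P where "P = (\<lambda>i. \<Sum>r<m. (\<Sum>j\<in>I. e r j * u j) * (e r i * \<sigma> i))"
  have \<psi>v: "\<psi> (v i) = \<psi> u + 2 * P i + m - \<beta> * (2 * (u i * \<sigma> i) + 1)"
    if "i \<in> I" for i
  proof -
    have "(\<Sum>r<m. (\<Sum>j\<in>I. e r j * v i j)\<^sup>2) = (\<Sum>r<m. (\<Sum>j\<in>I. e r j * u j)\<^sup>2) + 2 * P i + m"
      unfolding row[OF that] P_def by (simp add: sum.distrib mult.assoc flip: sum_distrib_left)
    then show ?thesis
      unfolding \<psi>_def square[OF that] by (simp add: right_diff_distrib distrib_left mult.assoc)
  qed
  \<comment> \<open>The cross terms of all rows average out because \<open>y\<close> lies in their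
    kernel.\<close>
  have mean1: "(\<Sum>i\<in>I. \<bar>y i\<bar> * P i) = 0"
  proof -
    have "(\<Sum>i\<in>I. \<bar>y i\<bar> * P i)
        = (\<Sum>i\<in>I. \<Sum>r<m. (\<Sum>j\<in>I. e r j * u j) * (e r i * (\<bar>y i\<bar> * \<sigma> i)))"
      unfolding P_def sum_distrib_left by (intro sum.cong refl) (simp only: mult_ac)
    also have "\<dots> = (\<Sum>r<m. (\<Sum>j\<in>I. e r j * u j) * (\<Sum>i\<in>I. e r i * y i))"
      unfolding \<sigma>(1) by (subst sum.swap) (simp add: sum_distrib_left)
    also have "\<dots> = 0"
      using ker by simp
    finally show ?thesis .
  qed
  have mean2: "(\<Sum>i\<in>I. \<bar>y i\<bar> * (u i * \<sigma> i)) = (\<Sum>i\<in>I. u i * y i)"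
  proof -
    have "(\<Sum>i\<in>I. \<bar>y i\<bar> * (u i * \<sigma> i)) = (\<Sum>i\<in>I. u i * (\<bar>y i\<bar> * \<sigma> i))"
      by (simp add: mult_ac)
    then show ?thesis
      unfolding \<sigma>(1) .
  qed
  have mean3: "(\<Sum>i\<in>I. \<bar>y i\<bar> * \<bar>y i\<bar>) = Y"
    by (simp add: Y_def power2_eq_square)
  define c where "c = (\<Sum>i\<in>I. u i * y i)"
  have split: "\<bar>y i\<bar> * \<phi> (v i) k
      = \<bar>y i\<bar> * (\<psi> u + m - \<beta> + k * m - \<beta> * (2 * k * c + k * (real k - 1) * Y + k))
      + 2 * (\<bar>y i\<bar> * P i)
      - 2 * \<beta> * (\<bar>y i\<bar> * (u i * \<sigma> i)) - 2 * \<beta> * k * (\<bar>y i\<bar> * \<bar>y i\<bar>)" if "i \<in> I" for i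
    unfolding \<phi>_def \<psi>v[OF that] inner[OF that] c_def[symmetric]
    by (simp only: of_int_mult) (simp add: algebra_simps del: abs_mult_self_eq)
  have "(\<Sum>i\<in>I. \<bar>y i\<bar> * \<phi> (v i) k)
      = (\<psi> u + m - \<beta> + k * m - \<beta> * (2 * k * c + k * (real k - 1) * Y + k)) - 2 * \<beta> * c - 2 * \<beta> * k * Y"
    using mean1 mean2 mean3 y
    by (simp add: split sum.distrib sum_subtractf c_def
        del: of_nat_Suc flip: sum_distrib_left sum_distrib_right)
  also have "\<dots> = \<phi> u (Suc k)"
    unfolding \<phi>_def c_def[symmetric] by (simp add: algebra_simps)
  finally have mean: "(\<Sum>i\<in>I. \<bar>y i\<bar> * \<phi> (v i) k) = \<phi> u (Suc k)" .
  obtain i where i: "i \<in> I" "\<phi> (v i) k \<le> \<phi> u (Suc k)"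
    using exists_le_weighted_sum[OF I, of "\<lambda>i. \<bar>y i\<bar>" "\<lambda>i. \<phi> (v i) k"] y mean by auto
  obtain z where z: "(\<Sum>j\<in>I. \<bar>z j - v i j\<bar>) \<le> int k" "\<psi> z \<le> \<phi> (v i) k"
    using Suc.IH[of "v i"] by (auto simp: \<phi>_def \<psi>_def Y_def)
  have "(\<Sum>j\<in>I. \<bar>z j - u j\<bar>) \<le> (\<Sum>j\<in>I. \<bar>z j - v i j\<bar> + (if j = i then 1 else 0))"
    using \<sigma>(3)[of i] by (intro sum_mono) (auto simp: v_def)
  also have "\<dots> \<le> int (Suc k)"
    using z(1) I i(1) by (simp add: sum.distrib)
  finally show ?case
    using z(2) i(2) by (intro exI[of _ z]) (auto simp: \<phi>_def \<psi>_def Y_def)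
qed

lemma sum_squares_le_square_sum_abs:
  "(\<Sum>i\<in>I. (x i)\<^sup>2) \<le> (\<Sum>i\<in>I. \<bar>x i\<bar> :: real)\<^sup>2"
proof -
  have "sqrt (\<Sum>i\<in>I. (x i)\<^sup>2) \<le> (\<Sum>i\<in>I. \<bar>x i\<bar>)"
    using L2_set_le_sum_abs[of x I] by (simp add: L2_set_def)
  then show ?thesis
    by (metis sqrt_le_D)
qed

text \<open>Normalise \<open>x\<close> to \<open>y\<close> with l1-norm 1 and sample
  \<open>s\<close> steps from 0 with \<open>\<beta> = m / 10\<close>. The hypothesis on
  \<open>A\<close> makes the left-hand side of the sampling bound nonnegative, and nonnegativity of
  the right-hand side reads \<open>(s - 1) * Y + 1 \<le> 10\<close>.\<close>

lemma kernel_bound_of_sign_patterns: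
  fixes A :: "nat \<Rightarrow> 'a set"
  assumes I: "finite I" and m: "1 \<le> m" and s: "2 \<le> s"
    and A: "\<And>z :: 'a \<Rightarrow> int. (\<Sum>i\<in>I. \<bar>z i\<bar>) \<le> int s \<Longrightarrow>
     real m / 10 * (\<Sum>i\<in>I. (real_of_int (z i))\<^sup>2) \<le> (\<Sum>r<m. (signed_sum I (A r) (\<lambda>i. real_of_int (z i)))\<^sup>2)"
    and ker: "\<And>r. r < m \<Longrightarrow> signed_sum I (A r) x = 0"
  shows "(\<Sum>i\<in>I. (x i)\<^sup>2) \<le> 10 / (real s - 1) * (\<Sum>i\<in>I. \<bar>x i\<bar>)\<^sup>2"
proof (cases "(\<Sum>i\<in>I. \<bar>x i\<bar>) = 0")
  case True
  then show ?thesis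
    using sum_squares_le_square_sum_abs[of x I] by simp
next
  case False
  define R where "R = (\<Sum>i\<in>I. \<bar>x i\<bar>)"
  have "0 \<le> R"
    unfolding R_def by (rule sum_nonneg) simp
  then have R: "0 < R"
    using False by (simp add: R_def[symmetric])
  define y where "y = (\<lambda>i. x i / R)"
  define e where "e = (\<lambda>r i. if i \<in> A r then 1 else - 1 :: real)"
  define Y where "Y = (\<Sum>i\<in>I. (y i)\<^sup>2)"
  have 1: "(\<Sum>i\<in>I. \<bar>y i\<bar>) = 1"
    using R by (simp add: y_def flip: sum_divide_distrib) (simp add: R_def)
  have 2: "(\<Sum>i\<in>I. e r i * y i) = 0" if "r < m" for r
    using ker[OF that] by (simp add: y_def e_def signed_sum_def flip: sum_divide_distrib)
  have 3: "(e r i)\<^sup>2 = 1" for r i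
    by (simp add: e_def)
  obtain z :: "'a \<Rightarrow> int" where z: "(\<Sum>i\<in>I. \<bar>z i - 0\<bar>) \<le> int s"
    "(\<Sum>r<m. (\<Sum>i\<in>I. e r i * z i)\<^sup>2) - m / 10 * (\<Sum>i\<in>I. (real_of_int (z i))\<^sup>2)
      \<le> s * m - m / 10 * (s * (real s - 1) * Y + s)"
    using maurey_sampling[where e = e and y = y and m = m and u = "\<lambda>_. 0" and k = s and \<beta> = "real m / 10", OF I 3 1 2] unfolding Y_def by auto
  have "real m / 10 * (\<Sum>i\<in>I. (real_of_int (z i))\<^sup>2) \<le> (\<Sum>r<m. (\<Sum>i\<in>I. e r i * z i)\<^sup>2)"
    using A[of z] z(1) by (simp add: e_def signed_sum_def)
  then have "0 \<le> s * m - m / 10 * (s * (real s - 1) * Y + s)"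
    using z(2) by linarith
  moreover have "s * m - m / 10 * (s * (real s - 1) * Y + s) = real s * real m * (1 - ((real s - 1) * Y + 1) / 10)"
    by (simp add: field_simps)
  ultimately have "0 \<le> real s * real m * (1 - ((real s - 1) * Y + 1) / 10)"
    by simp
  moreover have "0 < real s * real m"
    using m s by simp
  ultimately have "0 \<le> 1 - ((real s - 1) * Y + 1) / 10"
    by (rule mult_left_le_imp_le[where a = 0, unfolded mult_zero_right])
  then have "(real s - 1) * Y \<le> 10"
    by simp
  then have "Y \<le> 10 / (real s - 1)"
    using s by (simp add: field_simps)
  moreover have "Y = (\<Sum>i\<in>I. (x i)\<^sup>2) / R\<^sup>2"
    by (simp add: Y_def y_def power_divide sum_divide_distrib)
  ultimately show ?thesis
    using R by (simp add: R_def[symmetric] field_simps)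
qed

section \<open>From the sampling length to the number of functionals\<close>

lemma ln_80_ge: "4 \<le> ln (80 :: real)"
proof -
  have "ln (80 :: real) = ln (2 ^ 4 * 5)"
    by simp
  also have "\<dots> = ln (2 ^ 4) + ln 5"
    by (rule ln_mult_pos) auto
  also have "ln (2 ^ 4 :: real) = 4 * ln 2"
    by (simp only: ln_realpow)
  finally have "ln (80 :: real) = 4 * ln 2 + ln 5" .
  moreover have "2 * ln (2 :: real) \<le> ln 5"
  proof -
    have "2 * ln (2 :: real) = ln (2 ^ 2)"
      by (simp only: ln_realpow)
    also have "\<dots> \<le> ln 5"
      by simp
    finally show ?thesis .
  qed
  ultimately show ?thesis
    using ln2_ge_two_thirds by linarith
qed

text \<open>The largest sampling length allowed by the union bound is the integer part of
  \<open>\<sigma> = m / (20 * l)\<close>. If \<open>\<sigma> < 2\<close>, the constant exceeds 1 and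
  the l2-norm is bounded by the l1-norm anyway.\<close>

lemma kernel_l2_le_l1_nat:
  fixes I :: "'a set" and K :: real
  assumes I: "finite I" "real (card I) \<le> K" and m: "1 \<le> m" "real m \<le> K"
  shows "\<exists>c :: nat \<Rightarrow> 'a \<Rightarrow> real. \<forall>x. (\<forall>r<m. (\<Sum>i\<in>I. c r i * x i) = 0) \<longrightarrow>
    (\<Sum>i\<in>I. (x i)\<^sup>2) \<le> 600 * ln (80 * K / m) / m * (\<Sum>i\<in>I. \<bar>x i\<bar>)\<^sup>2"
proof -
  define l where "l = ln (80 * K / m)"
  have "ln 80 \<le> l"
    using m by (simp add: l_def field_simps)
  then have l: "4 \<le> l"
    using ln_80_ge by linarith
  define \<sigma> where "\<sigma> = m / (20 * l)"
  have \<sigma>: "0 < \<sigma>"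
    using m l by (simp add: \<sigma>_def)
  have C: "600 * l / m = 30 / \<sigma>"
    using m l by (simp add: \<sigma>_def)
  show ?thesis
  proof (cases "2 \<le> \<sigma>")
    case False
    have "(\<Sum>i\<in>I. (x i)\<^sup>2) \<le> 30 / \<sigma> * (\<Sum>i\<in>I. \<bar>x i\<bar>)\<^sup>2" for x :: "'a \<Rightarrow> real"
    proof -
      have "1 * (\<Sum>i\<in>I. \<bar>x i\<bar>)\<^sup>2 \<le> 30 / \<sigma> * (\<Sum>i\<in>I. \<bar>x i\<bar>)\<^sup>2"
        using False \<sigma> by (intro mult_right_mono) (auto simp: field_simps)
      then show ?thesis
        using sum_squares_le_square_sum_abs[of x I] by linarith
    qed
    then show ?thesis
      unfolding l_def[symmetric] C by blast
  next
    case True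
    define s where "s = nat \<lfloor>\<sigma>\<rfloor>"
    have s: "2 \<le> s" "real s \<le> \<sigma>" "\<sigma> < real s + 1"
      using True by (auto simp: s_def le_nat_floor)
    have "real s * l \<le> \<sigma> * l"
      using s l by (intro mult_right_mono) auto
    also have "\<dots> = real m / 20"
      using l by (simp add: \<sigma>_def)
    finally obtain A where A: "\<forall>z :: 'a \<Rightarrow> int. (\<Sum>i\<in>I. \<bar>z i\<bar>) \<le> int s \<longrightarrow>
     real m / 10 * (\<Sum>i\<in>I. (real_of_int (z i))\<^sup>2) \<le> (\<Sum>r<m. (signed_sum I (A r) (\<lambda>i. real_of_int (z i)))\<^sup>2)"
      using exists_sign_patterns[OF I m, of s] unfolding l_def by blast
    \<comment> \<open>Rounding down costs a factor 3:
      \<open>\<sigma> < s + 1 \<le> 3 * (s - 1)\<close> for \<open>s \<ge> 2\<close>.\<close>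
    have "\<sigma> / 3 \<le> real s - 1"
      using s by linarith
    then have le: "10 / (real s - 1) \<le> 30 / \<sigma>"
      using \<sigma> s by (simp add: field_simps)
    show ?thesis
      unfolding l_def[symmetric] C
    proof (intro exI[of _ "\<lambda>r i. if i \<in> A r then 1 else - 1"] allI impI)
      fix x :: "'a \<Rightarrow> real"
      assume "\<forall>r<m. (\<Sum>i\<in>I. (if i \<in> A r then 1 else - 1) * x i) = 0"
      then have "(\<Sum>i\<in>I. (x i)\<^sup>2) \<le> 10 / (real s - 1) * (\<Sum>i\<in>I. \<bar>x i\<bar>)\<^sup>2"
        using A by (intro kernel_bound_of_sign_patterns[OF I(1) m(1) s(1), of A]) (auto simp: signed_sum_def)
      also have "\<dots> \<le> 30 / \<sigma> * (\<Sum>i\<in>I. \<bar>x i\<bar>)\<^sup>2"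
        using le by (intro mult_right_mono) auto
      finally show "(\<Sum>i\<in>I. (x i)\<^sup>2) \<le> 30 / \<sigma> * (\<Sum>i\<in>I. \<bar>x i\<bar>)\<^sup>2" .
    qed
  qed
qed

text \<open>The version for a real budget \<open>\<mu>\<close>, as supplied by geometrically
  decreasing shares. Rounding down costs at most a factor 2 in the denominator and a factor 2 in the
  logarithm; for \<open>\<mu> < 1\<close> no functional is available, but the constant exceeds
  1.\<close>

lemma kernel_l2_le_l1:
  fixes I :: "'a set" and K \<mu> :: real
  assumes I: "finite I" "real (card I) \<le> K" and \<mu>: "0 < \<mu>" "\<mu> \<le> K"
  shows "\<exists>c :: nat \<Rightarrow> 'a \<Rightarrow> real. \<forall>x. (\<forall>r<nat \<lfloor>\<mu>\<rfloor>. (\<Sum>i\<in>I. c r i * x i) = 0) \<longrightarrow>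
    (\<Sum>i\<in>I. (x i)\<^sup>2) \<le> 2400 * ln (80 * K / \<mu>) / \<mu> * (\<Sum>i\<in>I. \<bar>x i\<bar>)\<^sup>2"
proof -
  have "ln 80 \<le> ln (80 * K / \<mu>)"
    using \<mu> by (simp add: field_simps)
  then have l: "4 \<le> ln (80 * K / \<mu>)"
    using ln_80_ge by linarith
  show ?thesis
  proof (cases "1 \<le> \<mu>")
    case False
    then have "1 \<le> 2400 * ln (80 * K / \<mu>) / \<mu>"
      using l \<mu> by (simp add: field_simps)
    then have "1 * (\<Sum>i\<in>I. \<bar>x i\<bar>)\<^sup>2 \<le> 2400 * ln (80 * K / \<mu>) / \<mu> * (\<Sum>i\<in>I. \<bar>x i\<bar>)\<^sup>2"
      for x :: "'a \<Rightarrow> real"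
      by (rule mult_right_mono) auto
    then show ?thesis
      using order_trans[OF sum_squares_le_square_sum_abs] unfolding mult_1 by blast
  next
    case True
    define m where "m = nat \<lfloor>\<mu>\<rfloor>"
    have m: "1 \<le> m" "real m \<le> \<mu>" "\<mu> < real m + 1"
      using True by (auto simp: m_def le_nat_floor)
    have "ln (80 * K / m) \<le> ln (80 * K / \<mu> * 2)"
      using m \<mu> by (subst ln_le_cancel_iff) (auto simp: field_simps)
    also have "\<dots> = ln (80 * K / \<mu>) + ln 2"
      using \<mu> by (intro ln_mult_pos) auto
    also have "\<dots> \<le> 2 * ln (80 * K / \<mu>)"
      using l ln_2_less_1 by linarith
    finally have "600 * ln (80 * K / m) / m \<le> 600 * (2 * ln (80 * K / \<mu>)) / m"
      by (intro divide_right_mono) auto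
    also have "\<dots> \<le> 600 * (2 * ln (80 * K / \<mu>)) / (\<mu> / 2)"
      using m \<mu> l by (intro divide_left_mono) auto
    finally have le: "600 * ln (80 * K / m) / m \<le> 2400 * ln (80 * K / \<mu>) / \<mu>"
      by simp
    have "real m \<le> K"
      using m \<mu> by linarith
    from kernel_l2_le_l1_nat[OF I m(1) this] obtain c :: "nat \<Rightarrow> 'a \<Rightarrow> real" where
      c: "\<forall>x. (\<forall>r<m. (\<Sum>i\<in>I. c r i * x i) = 0) \<longrightarrow>
        (\<Sum>i\<in>I. (x i)\<^sup>2) \<le> 600 * ln (80 * K / m) / m * (\<Sum>i\<in>I. \<bar>x i\<bar>)\<^sup>2"
      by blast
    show ?thesis
      unfolding m_def[symmetric]
    proof (intro exI[of _ c] allI impI)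
      fix x :: "'a \<Rightarrow> real"
      assume "\<forall>r<m. (\<Sum>i\<in>I. c r i * x i) = 0"
      then have "(\<Sum>i\<in>I. (x i)\<^sup>2) \<le> 600 * ln (80 * K / m) / m * (\<Sum>i\<in>I. \<bar>x i\<bar>)\<^sup>2"
        using c by blast
      also have "\<dots> \<le> 2400 * ln (80 * K / \<mu>) / \<mu> * (\<Sum>i\<in>I. \<bar>x i\<bar>)\<^sup>2"
        using le by (rule mult_right_mono) simp
      finally show "(\<Sum>i\<in>I. (x i)\<^sup>2) \<le> 2400 * ln (80 * K / \<mu>) / \<mu> * (\<Sum>i\<in>I. \<bar>x i\<bar>)\<^sup>2" .
    qed
  qed
qed

subsection \<open>Sequence space norms and functionals\<close>

definition level_weight :: "nat \<Rightarrow> real \<Rightarrow> ereal \<Rightarrow> nat \<Rightarrow> real" where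
  "level_weight d s p j = 2 powr (real j * (s + real d * (1/2 - invp p)))"

lemma level_weight_pos [simp]: "0 < level_weight d s p j" "level_weight d s p j \<noteq> 0"
  by (simp_all add: level_weight_def)

definition level_norm :: "nat \<Rightarrow> (nat \<Rightarrow> idx set) \<Rightarrow> real \<Rightarrow> ereal \<Rightarrow> seqn \<Rightarrow> nat \<Rightarrow> real" where
  "level_norm d Nb s p a j = level_weight d s p j * lpn p (Nb j) (a j)"

lemma lpn_nonneg:
  assumes "finite A"
  shows "0 \<le> lpn p A f"
  using assms by (auto simp: lpn_def)

lemma abs_le_lpn:
  assumes "finite A" "x \<in> A" "0 < p"
  shows "\<bar>f x\<bar> \<le> lpn p A f"
proof (cases p)
  case (real r)
  then have r: "0 < r" using assms by simp
  have "\<bar>f x\<bar> powr r \<le> (\<Sum>y\<in>A. \<bar>f y\<bar> powr r)"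
    using assms by (intro member_le_sum) auto
  then have "(\<bar>f x\<bar> powr r) powr (1 / r) \<le> (\<Sum>y\<in>A. \<bar>f y\<bar> powr r) powr (1 / r)"
    using r by (intro powr_mono2) auto
  then show ?thesis
    using r real by (simp add: lpn_def powr_powr)
next
  case PInf
  then show ?thesis
    using assms by (auto simp: lpn_def intro!: Max_ge)
qed (use assms in simp)

lemma lpn_le:
  assumes "finite A" "A \<noteq> {}" "0 < p" and f: "\<And>x. x \<in> A \<Longrightarrow> \<bar>f x\<bar> \<le> \<kappa>"
  shows "lpn p A f \<le> \<kappa> * real (card A) powr invp p"
proof -
  obtain x where "x \<in> A" using assms by blast
  then have \<kappa>: "0 \<le> \<kappa>" using f[of x] by linarith
  show ?thesis
  proof (cases p)
    case (real r)
    then have r: "0 < r" using assms by simp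
    have "(\<Sum>x\<in>A. \<bar>f x\<bar> powr r) \<le> (\<Sum>x\<in>A. \<kappa> powr r)"
      using f r by (intro sum_mono powr_mono2) auto
    then have "(\<Sum>x\<in>A. \<bar>f x\<bar> powr r) powr (1 / r) \<le> (real (card A) * \<kappa> powr r) powr (1 / r)"
      using r by (intro powr_mono2) (auto intro!: sum_nonneg)
    then show ?thesis
      using r \<kappa> real by (simp add: lpn_def invp_def powr_mult powr_powr mult.commute)
  next
    case PInf
    then show ?thesis
      using assms \<kappa> by (auto simp: lpn_def invp_def)
  qed (use assms in simp)
qed

lemma lpn_eq_0:
  assumes "\<And>x. x \<in> A \<Longrightarrow> f x = 0"
  shows "lpn p A f = 0"
proof (cases "A = {}")
  case False
  have "(\<lambda>x. \<bar>f x\<bar>) ` A = {0}"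
    using assms False by force
  then show ?thesis
    using assms by (simp add: lpn_def)
qed (simp add: lpn_def)

lemma lpn_2: "lpn 2 A f = sqrt (\<Sum>x\<in>A. (f x)\<^sup>2)"
  by (simp add: lpn_def powr_half_sqrt sum_nonneg)

lemma level_norm_nonneg:
  assumes "finite (Nb j)"
  shows "0 \<le> level_norm d Nb s p a j"
  using lpn_nonneg[OF assms] by (simp add: level_norm_def less_imp_le)

lemma bnorm_ereal:
  "bnorm d Nb s p (ereal r) a =
     (if (\<Sum>j. ennreal ((level_norm d Nb s p a j) powr r)) = \<infinity> then \<infinity>
      else ennreal (enn2real (\<Sum>j. ennreal ((level_norm d Nb s p a j) powr r)) powr (1 / r)))"
  by (simp add: bnorm_def level_norm_def level_weight_def Let_def del: suminf_ennreal)

lemma bnorm_PInf: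
  "bnorm d Nb s p \<infinity> a = (SUP j. ennreal (level_norm d Nb s p a j))"
  by (simp add: bnorm_def level_norm_def level_weight_def)

text \<open>A single term is at most the whole \<open>q\<close>-sum or supremum. The upper bounds
  use \<open>q\<close> only through this inequality, hence their rates do not depend on it.\<close>

lemma level_le_bnorm:
  assumes "finite (Nb j)" "0 < q"
  shows "ennreal (level_norm d Nb s p a j) \<le> bnorm d Nb s p q a"
proof (cases q)
  case (real r)
  then have r: "0 < r" using assms by simp
  define w where "w = level_norm d Nb s p a"
  define S where "S = (\<Sum>j. ennreal (w j powr r))"
  have w: "0 \<le> w j"
    unfolding w_def by (rule level_norm_nonneg[where Nb = Nb, OF assms(1)])
  have "ennreal (w j powr r) = (\<Sum>i\<in>{j}. ennreal (w i powr r))"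
    by simp
  also have "\<dots> \<le> S"
    unfolding S_def by (intro sum_le_suminf summableI) auto
  finally have le: "ennreal (w j powr r) \<le> S" .
  have "ennreal (w j) \<le> ennreal (enn2real S powr (1 / r))" if "S \<noteq> \<infinity>"
  proof -
    have "w j powr r \<le> enn2real S"
      using le that by (metis enn2real_ennreal enn2real_mono infinity_ennreal_def powr_ge_zero top.not_eq_extremum)
    then have "(w j powr r) powr (1 / r) \<le> enn2real S powr (1 / r)"
      using r by (intro powr_mono2) auto
    then show ?thesis
      using r w by (simp add: powr_powr ennreal_leI)
  qed
  then show ?thesis
    unfolding real bnorm_ereal w_def[symmetric] S_def[symmetric] by auto
next
  case PInf
  then show ?thesis
    unfolding PInf bnorm_PInf by (intro SUP_upper) auto
qed (use assms in simp)

lemma bnorm_2_2_le: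
  assumes "\<And>j. finite (Nb j)"
    and le: "\<And>j. (2 powr (real j * s) * lpn 2 (Nb j) (a j))\<^sup>2 \<le> \<beta> j"
    and "summable \<beta>" "suminf \<beta> \<le> B\<^sup>2" "0 \<le> B"
  shows "bnorm d Nb s 2 2 a \<le> ennreal B"
proof -
  define w where "w = level_norm d Nb s 2 a"
  have w: "0 \<le> w j" for j
    unfolding w_def by (rule level_norm_nonneg[where Nb = Nb, OF assms(1)])
  have "w j = 2 powr (real j * s) * lpn 2 (Nb j) (a j)" for j
    by (simp add: w_def level_norm_def level_weight_def invp_def)
  then have le': "w j powr 2 \<le> \<beta> j" for j
    using le[of j] w[of j] by (simp add: powr_numeral)
  have \<beta>0: "0 \<le> \<beta> j" for j
    using le'[of j] powr_ge_zero[of "w j" 2] by linarith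
  define S where "S = (\<Sum>j. ennreal (w j powr 2))"
  have "S \<le> (\<Sum>j. ennreal (\<beta> j))"
    unfolding S_def using le' by (intro suminf_le summableI) (auto intro: ennreal_leI)
  also have "\<dots> = ennreal (suminf \<beta>)"
    using assms(3) \<beta>0 by (intro suminf_ennreal2) auto
  also have "\<dots> \<le> ennreal (B\<^sup>2)"
    using assms(4) by (rule ennreal_leI)
  finally have S: "S \<le> ennreal (B\<^sup>2)" .
  then have "S \<noteq> \<infinity>"
    using neq_top_trans by (metis ennreal_neq_top infinity_ennreal_def)
  have "enn2real S \<le> B\<^sup>2"
    using S enn2real_leI by simp
  then have "enn2real S powr (1 / 2) \<le> (B\<^sup>2) powr (1 / 2)"
    by (intro powr_mono2) auto
  also have "\<dots> = B"
    using assms(5) by (simp add: powr_half_sqrt)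
  finally have "ennreal (enn2real S powr (1 / 2)) \<le> ennreal B"
    by (rule ennreal_leI)
  moreover have "bnorm d Nb s 2 2 a = bnorm d Nb s 2 (ereal 2) a"
    by simp
  ultimately show ?thesis
    using \<open>S \<noteq> \<infinity>\<close> unfolding bnorm_ereal w_def[symmetric] S_def[symmetric] by simp
qed

text \<open>Only one term of the \<open>q\<close>-sum survives, so the index \<open>q\<close>
  disappears; the test sequences of the lower bound are of this kind.\<close>

lemma bnorm_single_level:
  assumes "finite (Nb j)" "0 < q" and a: "\<And>i x. i \<noteq> j \<Longrightarrow> a i x = 0"
  shows "bnorm d Nb s p q a = ennreal (level_norm d Nb s p a j)"
proof -
  define w where "w = level_norm d Nb s p a"
  have w: "0 \<le> w j"
    unfolding w_def by (rule level_norm_nonneg[where Nb = Nb, OF assms(1)])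
  have w0: "w i = 0" if "i \<noteq> j" for i
    using a[OF that] by (simp add: w_def level_norm_def lpn_eq_0)
  show ?thesis
  proof (cases q)
    case (real r)
    then have r: "0 < r" using assms by simp
    have "(\<Sum>j. ennreal (w j powr r)) = (\<Sum>i\<in>{j}. ennreal (w i powr r))"
      using w0 by (intro suminf_finite) auto
    then show ?thesis
      using r w unfolding real bnorm_ereal w_def[symmetric] by (simp add: powr_powr)
  next
    case PInf
    have "(SUP i. ennreal (w i)) = ennreal (w j)"
    proof (intro antisym SUP_least SUP_upper)
      show "ennreal (w i) \<le> ennreal (w j)" for i
        using w0[of i] by (cases "i = j") auto
    qed auto
    then show ?thesis
      unfolding PInf bnorm_PInf w_def[symmetric] .
  qed (use assms in simp)
qed

text \<open>Each coordinate is dominated by its level norm and hence by the quasi-norm, so norm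
  convergence implies coordinatewise convergence; the functional is a finite combination of
  coordinates.\<close>

lemma cont_lin_functional_level:
  fixes c :: "idx \<Rightarrow> real"
  assumes fin: "finite (Nb j)" and "0 < p" "0 < q"
  shows "cont_lin_functional d Nb s p q (\<lambda>a. \<Sum>x\<in>Nb j. c x * a j x)"
  unfolding cont_lin_functional_def
proof (intro conjI ballI allI impI)
  fix X :: "nat \<Rightarrow> seqn" and a :: seqn
  assume lim: "(\<lambda>k. bnorm d Nb s p q (\<lambda>j x. X k j x - a j x)) \<longlonglongrightarrow> 0"
  have "(\<lambda>k. X k j x) \<longlonglongrightarrow> a j x" if x: "x \<in> Nb j" for x
  proof -
    have "(\<lambda>k. ennreal (level_weight d s p j * \<bar>X k j x - a j x\<bar>)) \<longlonglongrightarrow> 0"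
    proof (rule tendsto_sandwich[OF _ _ tendsto_const lim])
      show "\<forall>\<^sub>F k in sequentially. ennreal (level_weight d s p j * \<bar>X k j x - a j x\<bar>)
          \<le> bnorm d Nb s p q (\<lambda>j x. X k j x - a j x)"
      proof (intro always_eventually allI)
        fix k
        have "level_weight d s p j * \<bar>X k j x - a j x\<bar>
            \<le> level_weight d s p j * lpn p (Nb j) (\<lambda>x. X k j x - a j x)"
          using abs_le_lpn[OF fin x assms(2), of "\<lambda>x. X k j x - a j x"]
          by (intro mult_left_mono) (auto simp: less_imp_le)
        then show "ennreal (level_weight d s p j * \<bar>X k j x - a j x\<bar>)
            \<le> bnorm d Nb s p q (\<lambda>j x. X k j x - a j x)"
          using level_le_bnorm[where Nb = Nb, OF fin assms(3), of d s p "\<lambda>j x. X k j x - a j x"]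
          unfolding level_norm_def by (meson ennreal_leI order_trans)
      qed
    qed auto
    then have "(\<lambda>k. level_weight d s p j * \<bar>X k j x - a j x\<bar>) \<longlonglongrightarrow> 0"
      by (subst (asm) ennreal_tendsto_0_iff) (auto simp: less_imp_le)
    then have "(\<lambda>k. (1 / level_weight d s p j) * (level_weight d s p j * \<bar>X k j x - a j x\<bar>))
        \<longlonglongrightarrow> (1 / level_weight d s p j) * 0"
      by (rule tendsto_mult_left)
    then have "(\<lambda>k. \<bar>X k j x - a j x\<bar>) \<longlonglongrightarrow> 0"
      by simp
    then show ?thesis
      by (simp add: tendsto_rabs_zero_iff LIM_zero_iff)
  qed
  then show "(\<lambda>k. \<Sum>x\<in>Nb j. c x * X k j x) \<longlonglongrightarrow> (\<Sum>x\<in>Nb j. c x * a j x)"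
    by (intro tendsto_sum tendsto_mult tendsto_const)
qed (auto simp: algebra_simps sum.distrib sum_distrib_left)

text \<open>Splits the task by levels: the unit ball forces every level norm to be at most 1, so
  functionals and error bounds may be chosen on each level separately, and in the target norm the
  squared errors add up.\<close>

lemma gelfand_width_le_levels:
  fixes m :: "nat \<Rightarrow> nat" and c :: "nat \<Rightarrow> nat \<Rightarrow> idx \<Rightarrow> real"
  assumes fin: "\<And>j. finite (Nb j)" and "0 < p" "0 < q"
    and m0: "\<And>j. J0 < j \<Longrightarrow> m j = 0" and mn: "(\<Sum>j\<le>J0. m j) \<le> n"
    and le: "\<And>j f. (\<forall>r<m j. (\<Sum>x\<in>Nb j. c j r x * f x) = 0) \<Longrightarrow>
        level_weight d \<sigma> p j * lpn p (Nb j) f \<le> 1 \<Longrightarrow>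
        (2 powr (real j * s) * lpn 2 (Nb j) f)\<^sup>2 \<le> \<beta> j"
    and \<beta>: "summable \<beta>" "suminf \<beta> \<le> B\<^sup>2" "0 \<le> B"
  shows "gelfand_width d Nb n \<sigma> p q s 2 2 \<le> ennreal B"
proof -
  define F where "F = (\<lambda>(j, r). (\<lambda>a :: seqn. \<Sum>x\<in>Nb j. c j r x * a j x))"
  define P where "P = (SIGMA j:{..J0}. {..<m j})"
  have "finite P"
    by (simp add: P_def)
  have "card P \<le> n"
    using mn by (simp add: P_def card_SigmaI)
  obtain h where h: "bij_betw h {..<card P} P"
    using ex_bij_betw_nat_finite[OF \<open>finite P\<close>] by (auto simp: atLeast0LessThan)
  define L where "L = (\<lambda>i. if i < card P then F (h i) else (\<lambda>_. 0))"
  have "cont_lin_functional d Nb \<sigma> p q (\<lambda>_. 0)"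
    by (auto simp: cont_lin_functional_def)
  then have cont: "cont_lin_functional d Nb \<sigma> p q (L i)" for i
    using cont_lin_functional_level[OF fin assms(2,3)] by (auto simp: L_def F_def split: prod.split)
  have "bnorm d Nb s 2 2 a \<le> ennreal B"
    if a: "bnorm d Nb \<sigma> p q a \<le> 1" "\<forall>i<n. L i a = 0" for a
  proof (rule bnorm_2_2_le[OF fin _ \<beta>], rule le)
    fix j
    show "\<forall>r<m j. (\<Sum>x\<in>Nb j. c j r x * a j x) = 0"
    proof (intro allI impI)
      fix r assume "r < m j"
      then have "(j, r) \<in> P"
        using m0[of j] by (cases "j \<le> J0") (auto simp: P_def)
      then obtain i where "i < card P" "h i = (j, r)"
        using h by (metis bij_betw_def image_iff lessThan_iff)
      then show "(\<Sum>x\<in>Nb j. c j r x * a j x) = 0"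
        using a(2) \<open>card P \<le> n\<close> by (auto simp: L_def F_def dest!: spec[of _ i])
    qed
    have "ennreal (level_norm d Nb \<sigma> p a j) \<le> 1"
      using level_le_bnorm[OF fin assms(3)] a(1) by (rule order_trans)
    then show "level_weight d \<sigma> p j * lpn p (Nb j) (a j) \<le> 1"
      by (simp add: ennreal_le_1 level_norm_def)
  qed
  then have "(SUP a \<in> {a \<in> bspace d Nb \<sigma> p q. bnorm d Nb \<sigma> p q a \<le> 1 \<and> (\<forall>i<n. L i a = 0)}.
      bnorm d Nb s 2 2 a) \<le> ennreal B"
    by (intro SUP_least) auto
  then show ?thesis
    unfolding gelfand_width_def using cont by (intro INF_lower2[of L]) auto
qed

subsection \<open>Lower bounds\<close>

text \<open>Gaussian elimination: solve the last equation for a pivot coordinate \<open>b\<close>,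
  substitute into the others and recurse on \<open>A - {b}\<close>.\<close>

lemma exists_nonzero_kernel_vector:
  fixes c :: "nat \<Rightarrow> 'a \<Rightarrow> real"
  assumes "finite A" "n < card A"
  shows "\<exists>y. (\<exists>a\<in>A. y a \<noteq> 0) \<and> (\<forall>a. a \<notin> A \<longrightarrow> y a = 0) \<and> (\<forall>i<n. (\<Sum>a\<in>A. c i a * y a) = 0)"
  using assms
proof (induction n arbitrary: A c)
  case 0
  then obtain a where "a \<in> A" by fastforce
  then show ?case
    by (intro exI[of _ "\<lambda>x. if x = a then 1 else 0"]) auto
next
  case (Suc n)
  show ?case
  proof (cases "\<forall>a\<in>A. c n a = 0")
    case True
    obtain y where "\<exists>a\<in>A. y a \<noteq> 0" "\<forall>a. a \<notin> A \<longrightarrow> y a = 0" "\<forall>i<n. (\<Sum>a\<in>A. c i a * y a) = 0"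
      using Suc.IH[OF Suc.prems(1) Suc_lessD[OF Suc.prems(2)]] by blast
    then show ?thesis
      using True by (intro exI[of _ y]) (auto simp: less_Suc_eq)
  next
    case False
    then obtain b where b: "b \<in> A" "c n b \<noteq> 0" by blast
    define A' where "A' = A - {b}"
    have A': "finite A'" "n < card A'" "b \<notin> A'" "A = insert b A'"
      using Suc.prems b by (auto simp: A'_def)
    obtain y where y: "\<exists>a\<in>A'. y a \<noteq> 0" "\<forall>a. a \<notin> A' \<longrightarrow> y a = 0"
        "\<forall>i<n. (\<Sum>a\<in>A'. (c i a - c i b * c n a / c n b) * y a) = 0"
      using Suc.IH[OF A'(1,2), of "\<lambda>i a. c i a - c i b * c n a / c n b"] by blast
    define z where "z = y(b := - (\<Sum>a\<in>A'. c n a * y a) / c n b)"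
    have sum_z: "(\<Sum>a\<in>A. c i a * z a) = c i b * z b + (\<Sum>a\<in>A'. c i a * y a)" for i
    proof -
      have "(\<Sum>a\<in>A'. c i a * z a) = (\<Sum>a\<in>A'. c i a * y a)"
        using A'(3) by (intro sum.cong) (auto simp: z_def)
      then show ?thesis
        using A' by simp
    qed
    have zero: "(\<Sum>a\<in>A. c i a * z a) = 0" if "i < Suc n" for i
    proof (cases "i = n")
      case True
      then show ?thesis
        using b by (simp add: sum_z) (simp add: z_def)
    next
      case False
      then have "(\<Sum>a\<in>A'. (c i a - c i b * c n a / c n b) * y a) = 0"
        using y(3) that by auto
      then have "(\<Sum>a\<in>A'. c i a * y a) = (\<Sum>a\<in>A'. c i b / c n b * (c n a * y a))"
        by (simp add: left_diff_distrib sum_subtractf mult.assoc)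
      then show ?thesis
        unfolding sum_z by (simp add: z_def flip: sum_distrib_left sum_divide_distrib)
    qed
    show ?thesis
      using y(1,2) zero A'(3,4) by (intro exI[of _ z]) (auto simp: z_def)
  qed
qed

text \<open>A vertex of the section of the cube by a subspace of codimension at most \<open>n\<close>:
  while more than \<open>n\<close> coordinates have modulus below 1, some kernel vector supported on them
  moves the point to a further facet.\<close>

lemma exists_kernel_cube_vertex:
  fixes c :: "nat \<Rightarrow> 'a \<Rightarrow> real"
  assumes A: "finite A"
  shows "\<exists>v. (\<forall>a\<in>A. \<bar>v a\<bar> \<le> 1) \<and> (\<forall>i<n. (\<Sum>a\<in>A. c i a * v a) = 0) \<and> card A \<le> card {a\<in>A. \<bar>v a\<bar> = 1} + n"
proof -
  have "k \<le> card A - n \<Longrightarrow>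
      \<exists>v. (\<forall>a\<in>A. \<bar>v a\<bar> \<le> 1) \<and> (\<forall>i<n. (\<Sum>a\<in>A. c i a * v a) = 0) \<and> k \<le> card {a\<in>A. \<bar>v a\<bar> = 1}" for k
  proof (induction k)
    case 0
    show ?case by (intro exI[of _ "\<lambda>_. 0"]) auto
  next
    case (Suc k)
    then obtain v where v: "\<forall>a\<in>A. \<bar>v a\<bar> \<le> 1" "\<forall>i<n. (\<Sum>a\<in>A. c i a * v a) = 0" "k \<le> card {a\<in>A. \<bar>v a\<bar> = 1}"
      by auto
    define T where "T = {a\<in>A. \<bar>v a\<bar> = 1}"
    show ?case
    proof (cases "Suc k \<le> card T")
      case True
      then show ?thesis
        using v by (auto simp: T_def)
    next
      case False
      have "T \<subseteq> A" "finite T"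
        using A by (auto simp: T_def)
      then have "n < card (A - T)"
        using Suc.prems False by (simp add: card_Diff_subset)
      then obtain y where y: "\<exists>a\<in>A - T. y a \<noteq> 0" "\<forall>a. a \<notin> A - T \<longrightarrow> y a = 0"
          "\<forall>i<n. (\<Sum>a\<in>A - T. c i a * y a) = 0"
        using exists_nonzero_kernel_vector[of "A - T" n c] A by auto
      have y_ker: "(\<Sum>a\<in>A. c i a * y a) = 0" if "i < n" for i
      proof -
        have "(\<Sum>a\<in>A. c i a * y a) = (\<Sum>a\<in>A - T. c i a * y a)"
          using A y(2) by (intro sum.mono_neutral_right) auto
        then show ?thesis
          using y(3) that by simp
      qed
      define S where "S = {a\<in>A. y a \<noteq> 0}"
      \<comment> \<open>The step length along \<open>y\<close> at which coordinate \<open>a\<close>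
        reaches the face \<open>sgn (y a)\<close> of the cube. The smallest of these keeps the point
        inside and makes coordinate \<open>b\<close> extreme.\<close>
      define \<tau> where "\<tau> = (\<lambda>a. (1 - sgn (y a) * v a) / \<bar>y a\<bar>)"
      have S: "finite S" "S \<noteq> {}" "S \<inter> T = {}"
        using A y by (auto simp: S_def)
      then obtain b where b: "b \<in> S" "\<tau> b = Min (\<tau> ` S)"
        by (metis (no_types, lifting) Min_in finite_imageI image_iff image_is_empty)
      have \<tau>_min: "\<tau> b \<le> \<tau> a" if "a \<in> S" for a
        using that S by (simp add: b)
      have sgn_v: "\<bar>sgn (y a) * v a\<bar> = \<bar>v a\<bar>" if "a \<in> S" for a
        using that by (simp add: S_def abs_mult abs_sgn_eq)
      have "b \<in> A" "b \<notin> T" "y b \<noteq> 0"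
        using b S by (auto simp: S_def)
      then have "0 \<le> \<tau> b"
        using v(1) sgn_v[OF b(1)] by (fastforce simp: \<tau>_def)
      define w where "w = (\<lambda>a. v a + \<tau> b * y a)"
      have w_sgn: "sgn (y a) * w a = sgn (y a) * v a + \<tau> b * \<bar>y a\<bar>" for a
        by (simp add: w_def distrib_left abs_sgn[of "y a"] mult_ac)
      have w_le: "\<bar>w a\<bar> \<le> 1" if "a \<in> A" for a
      proof (cases "a \<in> S")
        case True
        have "\<tau> b * \<bar>y a\<bar> \<le> \<tau> a * \<bar>y a\<bar>"
          using \<tau>_min[OF True] by (intro mult_right_mono) auto
        also have "\<dots> = 1 - sgn (y a) * v a"
          using True by (simp add: \<tau>_def S_def)
        finally have "sgn (y a) * w a \<le> 1"
          by (simp add: w_sgn)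
        moreover have "\<bar>sgn (y a) * v a\<bar> \<le> 1" "0 \<le> \<tau> b * \<bar>y a\<bar>"
          using sgn_v[OF True] v(1) that \<open>0 \<le> \<tau> b\<close> by simp_all
        then have "- 1 \<le> sgn (y a) * w a"
          unfolding w_sgn by linarith
        ultimately have "\<bar>sgn (y a) * w a\<bar> \<le> 1"
          by simp
        then show ?thesis
          using True by (simp add: S_def abs_mult abs_sgn_eq)
      next
        case False
        then show ?thesis
          using v(1) that by (simp add: w_def S_def)
      qed
      have "sgn (y b) * w b = 1"
        using \<open>y b \<noteq> 0\<close> by (simp add: w_sgn) (simp add: \<tau>_def)
      then have wb: "\<bar>w b\<bar> = 1"
        using \<open>y b \<noteq> 0\<close> by (metis abs_mult abs_one abs_sgn_eq mult_1)
      \<comment> \<open>Since \<open>y\<close> vanishes on \<open>T\<close>, the coordinates already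
        extreme do not move.\<close>
      have "insert b T \<subseteq> {a\<in>A. \<bar>w a\<bar> = 1}"
        using wb \<open>b \<in> A\<close> S by (auto simp: T_def S_def w_def)
      then have "card (insert b T) \<le> card {a\<in>A. \<bar>w a\<bar> = 1}"
        using A by (intro card_mono) auto
      then have "Suc k \<le> card {a\<in>A. \<bar>w a\<bar> = 1}"
        using v(3) \<open>finite T\<close> \<open>b \<notin> T\<close> by (simp add: T_def)
      moreover have "(\<Sum>a\<in>A. c i a * w a) = 0" if "i < n" for i
      proof -
        have "(\<Sum>a\<in>A. c i a * w a) = (\<Sum>a\<in>A. c i a * v a) + \<tau> b * (\<Sum>a\<in>A. c i a * y a)"
          by (simp add: w_def distrib_left sum.distrib sum_distrib_left mult_ac)
        then show ?thesis
          using v(2) y_ker that by simp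
      qed
      ultimately show ?thesis
        using w_le by blast
    qed
  qed
  from this[of "card A - n"] show ?thesis
    by (simp add: le_diff_conv)
qed

section \<open>Functionals restricted to one level\<close>

definition single_level :: "nat \<Rightarrow> idx set \<Rightarrow> (idx \<Rightarrow> real) \<Rightarrow> seqn" where
  "single_level j B f = (\<lambda>i x. if i = j \<and> x \<in> B then f x else 0)"

lemma single_level_in_bspace:
  assumes "finite (Nb j)" "0 < q" "B \<subseteq> Nb j"
  shows "single_level j B f \<in> bspace d Nb s p q"
  using assms bnorm_single_level[of Nb j q "single_level j B f" d s p]
  by (auto simp: bspace_def single_level_def ennreal_less_top)

text \<open>Linearity over the finitely many unit sequences of a level turns an arbitrary functional
  into a coefficient vector, to which the statement on cube sections applies.\<close>

lemma cont_lin_functional_single_level: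
  assumes L: "cont_lin_functional d Nb s p q L" and fin: "finite (Nb j)" and "0 < q" "B \<subseteq> Nb j"
  shows "L (single_level j B f) = (\<Sum>x\<in>B. L (single_level j {x} (\<lambda>_. 1)) * f x)"
proof -
  have add: "L (\<lambda>j x. a j x + b j x) = L a + L b"
    if "a \<in> bspace d Nb s p q" "b \<in> bspace d Nb s p q" for a b
    using L that by (auto simp: cont_lin_functional_def)
  have scale: "L (\<lambda>j x. c * a j x) = c * L a" if "a \<in> bspace d Nb s p q" for a c
    using L that by (auto simp: cont_lin_functional_def)
  have "finite B"
    using assms finite_subset by blast
  then show ?thesis
    using \<open>B \<subseteq> Nb j\<close>
  proof (induction B rule: finite_induct)
    case empty
    have "L (\<lambda>i x. 0 * single_level j {} f i x) = 0"
      using scale[OF single_level_in_bspace[where Nb = Nb and B = "{}", OF fin \<open>0 < q\<close>], where c = 0] by simp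
    then show ?case
      by (simp add: single_level_def)
  next
    case (insert b B)
    have mem: "single_level j B f \<in> bspace d Nb s p q" "single_level j {b} (\<lambda>_. 1) \<in> bspace d Nb s p q"
      using insert.prems fin \<open>0 < q\<close> by (auto intro!: single_level_in_bspace)
    have "single_level j {b} f = (\<lambda>i x. f b * single_level j {b} (\<lambda>_. 1) i x)"
      by (auto simp: single_level_def fun_eq_iff)
    then have "L (single_level j {b} f) = f b * L (single_level j {b} (\<lambda>_. 1))"
      using scale mem by simp
    moreover have "single_level j (insert b B) f = (\<lambda>i x. single_level j B f i x + single_level j {b} f i x)"
      using insert.hyps by (auto simp: single_level_def fun_eq_iff)
    then have "L (single_level j (insert b B) f) = L (single_level j B f) + L (single_level j {b} f)"
      using add[OF mem(1) single_level_in_bspace[where Nb = Nb, OF fin \<open>0 < q\<close>]] insert.prems by simp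
    ultimately show ?case
      using insert by simp
  qed
qed

text \<open>The test sequence is a scaled vertex of the section of the cube on level
  \<open>j\<close>. At least \<open>N - n \<ge> N / 2\<close> of its coordinates are extreme, which
  bounds its l2-norm from below, while all coordinates are at most 1, which bounds its
  \<open>p\<close>-norm from above.\<close>

lemma level_le_gelfand_width:
  assumes fin: "finite (Nb j)" and pq: "0 < p" "0 < q" and n: "2 * n \<le> card (Nb j)" "Nb j \<noteq> {}"
  shows "ennreal (2 powr (real j * s) * sqrt (real (card (Nb j)) / 2)
      / (level_weight d \<sigma> p j * real (card (Nb j)) powr invp p)) \<le> gelfand_width d Nb n \<sigma> p q s 2 2"
  unfolding gelfand_width_def
proof (rule INF_greatest)
  fix L :: "nat \<Rightarrow> seqn \<Rightarrow> real"
  assume L: "L \<in> {L. \<forall>i<n. cont_lin_functional d Nb \<sigma> p q (L i)}"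
  define N where "N = real (card (Nb j))"
  have N: "0 < N"
    using n(2) fin by (simp add: N_def card_gt_0_iff)
  \<comment> \<open>Chosen so that a vector with all coordinates at most \<open>\<kappa>\<close> in
    modulus lies in the unit ball.\<close>
  define \<kappa> where "\<kappa> = 1 / (level_weight d \<sigma> p j * N powr invp p)"
  have \<kappa>: "0 < \<kappa>"
    using N by (simp add: \<kappa>_def)
  obtain v where v: "\<forall>x\<in>Nb j. \<bar>v x\<bar> \<le> 1" "\<forall>i<n. (\<Sum>x\<in>Nb j. L i (single_level j {x} (\<lambda>_. 1)) * v x) = 0"
      "card (Nb j) \<le> card {x\<in>Nb j. \<bar>v x\<bar> = 1} + n"
    using exists_kernel_cube_vertex[OF fin, of n "\<lambda>i x. L i (single_level j {x} (\<lambda>_. 1))"] by blast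
  define f where "f = (\<lambda>x. \<kappa> * v x)"
  define a where "a = single_level j (Nb j) f"
  have a_level: "lpn r (Nb j) (a j) = lpn r (Nb j) f" for r
    unfolding lpn_def by (simp add: a_def single_level_def)
  have bnorm_a: "bnorm d Nb u r q' a = ennreal (level_weight d u r j * lpn r (Nb j) f)" if "0 < q'" for u r q'
    using bnorm_single_level[where Nb = Nb, OF fin that, of a d u r] a_level
    by (simp add: level_norm_def) (simp add: a_def single_level_def)
  have "lpn p (Nb j) f \<le> \<kappa> * N powr invp p"
    unfolding N_def using \<kappa> v(1) by (intro lpn_le fin n(2) pq) (auto simp: f_def abs_mult mult_left_le)
  then have "level_weight d \<sigma> p j * lpn p (Nb j) f \<le> level_weight d \<sigma> p j * (\<kappa> * N powr invp p)"
    by (intro mult_left_mono) (auto simp: less_imp_le)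
  also have "\<dots> = 1"
    using N by (simp add: \<kappa>_def)
  finally have "bnorm d Nb \<sigma> p q a \<le> 1"
    by (simp add: bnorm_a[OF pq(2)] ennreal_le_1)
  moreover have "a \<in> bspace d Nb \<sigma> p q"
    unfolding a_def using fin pq by (intro single_level_in_bspace) auto
  moreover have "L i a = 0" if "i < n" for i
  proof -
    have "L i a = (\<Sum>x\<in>Nb j. L i (single_level j {x} (\<lambda>_. 1)) * f x)"
      unfolding a_def using L that by (intro cont_lin_functional_single_level[where Nb = Nb, OF _ fin pq(2)]) auto
    also have "\<dots> = \<kappa> * (\<Sum>x\<in>Nb j. L i (single_level j {x} (\<lambda>_. 1)) * v x)"
      by (simp add: f_def sum_distrib_left mult_ac)
    finally show ?thesis
      using v(2) that by simp
  qed
  ultimately have le_SUP: "bnorm d Nb s 2 2 a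
      \<le> (SUP a \<in> {a \<in> bspace d Nb \<sigma> p q. bnorm d Nb \<sigma> p q a \<le> 1 \<and> (\<forall>i<n. L i a = 0)}. bnorm d Nb s 2 2 a)"
    by (intro SUP_upper) auto
  have "N / 2 \<le> real (card {x\<in>Nb j. \<bar>v x\<bar> = 1})"
    using v(3) n(1) by (simp add: N_def)
  also have "\<dots> = (\<Sum>x\<in>{x\<in>Nb j. \<bar>v x\<bar> = 1}. 1)"
    by simp
  also have "\<dots> = (\<Sum>x\<in>{x\<in>Nb j. \<bar>v x\<bar> = 1}. (v x)\<^sup>2)"
    by (intro sum.cong refl) (simp add: abs_square_eq_1)
  also have "\<dots> \<le> (\<Sum>x\<in>Nb j. (v x)\<^sup>2)"
    using fin by (intro sum_mono2) auto
  finally have "sqrt (N / 2) \<le> sqrt (\<Sum>x\<in>Nb j. (v x)\<^sup>2)"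
    by simp
  then have "\<kappa> * sqrt (N / 2) \<le> lpn 2 (Nb j) f"
    unfolding lpn_2 using \<kappa> by (simp add: f_def power_mult_distrib real_sqrt_mult flip: sum_distrib_left)
  then have "2 powr (real j * s) * (\<kappa> * sqrt (N / 2)) \<le> level_weight d s 2 j * lpn 2 (Nb j) f"
    by (simp add: level_weight_def invp_def)
  then have "ennreal (2 powr (real j * s) * (\<kappa> * sqrt (N / 2))) \<le> bnorm d Nb s 2 2 a"
    by (simp add: bnorm_a ennreal_leI)
  then show "ennreal (2 powr (real j * s) * sqrt (real (card (Nb j)) / 2)
      / (level_weight d \<sigma> p j * real (card (Nb j)) powr invp p))
      \<le> (SUP a \<in> {a \<in> bspace d Nb \<sigma> p q. bnorm d Nb \<sigma> p q a \<le> 1 \<and> (\<forall>i<n. L i a = 0)}. bnorm d Nb s 2 2 a)"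
    using le_SUP by (simp add: \<kappa>_def N_def[symmetric])
qed

section \<open>The rate of the lower bound\<close>

lemma first_dyadic_level_above:
  assumes "1 \<le> d"
  obtains k :: nat where "y < 2 powr (real k * real d)" "\<And>i. i < k \<Longrightarrow> 2 powr (real i * real d) \<le> y"
proof -
  obtain k0 :: nat where "y < 2 ^ k0"
    using real_arch_pow[of 2 y] by auto
  also have "(2 :: real) ^ k0 \<le> 2 powr (real k0 * real d)"
    using assms mult_left_mono[of 1 "real d" "real k0"] by (simp add: powr_realpow[symmetric])
  finally have "y < 2 powr (real k0 * real d)" .
  then have "y < 2 powr (real (LEAST k. y < 2 powr (real k * real d)) * real d)"
    by (rule LeastI)
  then show thesis
    using not_less_Least[of _ "\<lambda>k. y < 2 powr (real k * real d)"] by (intro that) (auto simp: not_less)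
qed

text \<open>On a level with \<open>M = 2 powr (j * d)\<close> comparable to \<open>n\<close> and
  more than \<open>2 * n\<close> coordinates, the single-level bound equals
  \<open>M powr (- t / d)\<close> times a power of \<open>N / M\<close>, up to the factor
  \<open>sqrt 2\<close>. That ratio lies between \<open>C1\<close> and \<open>C2\<close>.\<close>

lemma gelfand_width_lower_bound:
  assumes d: "1 \<le> d" and adm: "admissible_index d Nb" and pq: "0 < p" "0 < q" and t: "0 < t"
  shows "\<exists>c>0. \<forall>n::nat\<ge>1. ennreal (c * real n powr (- t / real d)) \<le> gelfand_width d Nb n (s + t) p q s 2 2"
proof -
  have fin: "finite (Nb j)" for j
    using adm by (simp add: admissible_index_def)
  obtain C1 C2 J where C: "0 < C1" "C1 \<le> C2"
    and card: "\<And>j. J \<le> j \<Longrightarrow> C1 \<le> 2 powr (- real (j * d)) * real (card (Nb j))"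
      "\<And>j. J \<le> j \<Longrightarrow> 2 powr (- real (j * d)) * real (card (Nb j)) \<le> C2"
    using adm unfolding admissible_index_def by blast
  define e where "e = 1 / 2 - invp p"
  \<comment> \<open>The sign of \<open>e\<close> depends on \<open>p\<close>, so either endpoint of
    the range of \<open>N / M\<close> may give the minimum.\<close>
  define m where "m = min (C1 powr e) (C2 powr e)"
  \<comment> \<open>The first summand covers \<open>j = J\<close>; the second covers
    \<open>j = k > J\<close>, where minimality of \<open>k\<close> bounds level
    \<open>k - 1\<close>.\<close>
  define C where "C = 2 powr (real J * real d) + 2 powr real d * (2 / C1)"
  have Cpos: "0 < C"
    unfolding C_def using C(1) by (intro add_pos_pos) auto
  define c where "c = m / sqrt 2 * C powr (- t / real d)"
  have m: "0 < m"
    using C by (simp add: m_def)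
  have "ennreal (c * real n powr (- t / real d)) \<le> gelfand_width d Nb n (s + t) p q s 2 2"
    if n: "1 \<le> n" for n :: nat
  proof -
    obtain k :: nat where k: "2 * real n / C1 < 2 powr (real k * real d)"
      "\<And>i. i < k \<Longrightarrow> 2 powr (real i * real d) \<le> 2 * real n / C1"
      using first_dyadic_level_above[OF d] by blast
    \<comment> \<open>The cardinality bounds are only available from \<open>J\<close> on.\<close>
    define j where "j = max J k"
    define M where "M = 2 powr (real j * real d)"
    have M: "0 < M" by (simp add: M_def)
    have "2 powr (real k * real d) \<le> M"
      unfolding M_def j_def by (intro powr_mono mult_right_mono) auto
    then have "2 * real n / C1 < M"
      using k(1) by linarith
    then have nM: "2 * real n < C1 * M"
      using C by (simp add: pos_divide_less_eq mult.commute)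
    have "M \<le> C * real n"
    proof (cases "k \<le> J")
      case True
      then have "M = 2 powr (real J * real d) * 1"
        by (simp add: M_def j_def max_def)
      also have "\<dots> \<le> 2 powr (real J * real d) * real n"
        using n by (intro mult_left_mono) auto
      also have "\<dots> \<le> C * real n"
        using C by (intro mult_right_mono) (auto simp: C_def)
      finally show ?thesis .
    next
      case False
      then have "real j * real d = real d + real (k - 1) * real d"
        by (simp add: j_def max_def of_nat_diff algebra_simps)
      then have "M = 2 powr real d * 2 powr (real (k - 1) * real d)"
        by (simp add: M_def powr_add)
      also have "\<dots> \<le> 2 powr real d * (2 * real n / C1)"
        using k(2)[of "k - 1"] False by (intro mult_left_mono) auto
      also have "\<dots> = (2 powr real d * (2 / C1)) * real n"
        by simp
      also have "\<dots> \<le> C * real n"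
        by (intro mult_right_mono) (auto simp: C_def)
      finally show ?thesis .
    qed
    define N where "N = real (card (Nb j))"
    have MN: "2 powr (- real (j * d)) * N = N / M"
      by (simp add: M_def powr_minus divide_simps)
    have "J \<le> j" by (simp add: j_def)
    then have NM: "C1 \<le> N / M" "N / M \<le> C2"
      using card[of j] unfolding N_def[symmetric] MN by auto
    have N: "0 < N"
      using NM(1) C M by (metis less_le_trans zero_less_divide_iff order.asym)
    have "C1 * M \<le> N"
      using NM(1) M by (simp add: field_simps)
    then have "2 * n \<le> card (Nb j)"
      using nM by (simp add: N_def)
    have "Nb j \<noteq> {}"
      using N by (auto simp: N_def)
    have "m \<le> (N / M) powr e"
    proof (cases "0 \<le> e")
      case True
      then have "C1 powr e \<le> (N / M) powr e"
        using NM C by (intro powr_mono2) auto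
      then show ?thesis by (simp add: m_def)
    next
      case False
      then have "C2 powr e \<le> (N / M) powr e"
        using NM C N M by (intro powr_mono2') auto
      then show ?thesis by (simp add: m_def)
    qed
    have Mt: "2 powr (- real j * t) = M powr (- t / real d)"
      using d by (simp add: M_def powr_powr)
    have "(C * real n) powr (- t / real d) \<le> M powr (- t / real d)"
      using \<open>M \<le> C * real n\<close> M t d by (intro powr_mono2') (auto simp: divide_nonpos_pos)
    then have "c * real n powr (- t / real d) \<le> m / sqrt 2 * M powr (- t / real d)"
      using m Cpos by (simp add: c_def powr_mult mult_left_mono mult.assoc divide_right_mono)
    also have "\<dots> \<le> (N / M) powr e / sqrt 2 * M powr (- t / real d)"
      using \<open>m \<le> (N / M) powr e\<close> by (intro mult_right_mono divide_right_mono) auto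
    also have "\<dots> = 2 powr (real j * s) * sqrt (N / 2) / (level_weight d (s + t) p j * N powr invp p)"
    proof -
      have "level_weight d (s + t) p j = 2 powr (real j * s) * 2 powr (real j * t) * M powr e"
        unfolding level_weight_def M_def powr_powr powr_add[symmetric] e_def[symmetric]
        by (simp add: algebra_simps)
      moreover have "sqrt N = N powr e * N powr invp p"
        using N by (simp add: e_def powr_half_sqrt flip: powr_add)
      moreover have "2 powr (- real j * t) = 1 / 2 powr (real j * t)"
        by (simp add: powr_minus_divide)
      ultimately show ?thesis
        using N M unfolding Mt[symmetric] by (simp add: powr_divide real_sqrt_divide)
    qed
    finally have "ennreal (c * real n powr (- t / real d)) \<le> ennreal (2 powr (real j * s) * sqrt (N / 2)
        / (level_weight d (s + t) p j * N powr invp p))"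
      by (rule ennreal_leI)
    also have "\<dots> \<le> gelfand_width d Nb n (s + t) p q s 2 2"
      unfolding N_def by (rule level_le_gelfand_width) fact+
    finally show ?thesis .
  qed
  moreover have "0 < c"
    using m Cpos by (simp add: c_def)
  ultimately show ?thesis
    by blast
qed

subsection \<open>Upper bounds\<close>

lemma powr_sum_le:
  fixes y :: "'a \<Rightarrow> real"
  assumes A: "finite A" and c: "1 \<le> c" and y: "\<And>x. x \<in> A \<Longrightarrow> 0 \<le> y x"
  shows "(\<Sum>x\<in>A. y x) powr c \<le> real (card A) powr (c - 1) * (\<Sum>x\<in>A. y x powr c)"
proof -
  define P where "P = {x\<in>A. 0 < y x}"
  have P: "finite P" "P \<subseteq> A"
    using A by (auto simp: P_def)
  have "(\<Sum>x\<in>A. y x) = (\<Sum>x\<in>P. y x)"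
    using A y by (intro sum.mono_neutral_right) (auto simp: P_def less_le)
  moreover have "(\<Sum>x\<in>A. y x powr c) = (\<Sum>x\<in>P. y x powr c)"
    using A y by (intro sum.mono_neutral_right) (auto simp: P_def less_le)
  moreover have "(\<Sum>x\<in>P. y x) powr c \<le> real (card A) powr (c - 1) * (\<Sum>x\<in>P. y x powr c)"
  proof (cases "P = {}")
    case False
    define N where "N = real (card P)"
    have N: "0 < N"
      using False P by (simp add: N_def card_gt_0_iff)
    \<comment> \<open>Jensen's inequality with equal weights, on the positive terms only.\<close>
    have "(\<Sum>x\<in>P. (1 / N) *\<^sub>R y x) powr c \<le> (\<Sum>x\<in>P. 1 / N * y x powr c)"
      using N by (intro convex_on_sum[OF P(1) False powr_convex[OF c]]) (auto simp: P_def N_def)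
    then have "((\<Sum>x\<in>P. y x) / N) powr c \<le> (\<Sum>x\<in>P. y x powr c) / N"
      by (simp add: sum_divide_distrib)
    moreover have "((\<Sum>x\<in>P. y x) / N) powr c = (\<Sum>x\<in>P. y x) powr c / (N * N powr (c - 1))"
    proof -
      have "N powr c = N * N powr (c - 1)"
        using N powr_add[of N 1 "c - 1"] by simp
      then show ?thesis
        using N y P by (subst powr_divide) (auto intro!: sum_nonneg)
    qed
    ultimately have "(\<Sum>x\<in>P. y x) powr c \<le> N powr (c - 1) * (\<Sum>x\<in>P. y x powr c)"
      using N by (simp add: field_simps)
    also have "\<dots> \<le> real (card A) powr (c - 1) * (\<Sum>x\<in>P. y x powr c)"
      using c A P by (intro mult_right_mono powr_mono2 sum_nonneg) (auto simp: N_def card_mono)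
    finally show ?thesis .
  qed simp
  ultimately show ?thesis
    by simp
qed

text \<open>Hoelder's inequality in the form of power means: for finite \<open>p = u\<close>, the
  function \<open>\<bar>f x\<bar> powr r\<close> is raised to the power
  \<open>u / r \<ge> 1\<close>.\<close>

lemma lpn_le_lpn:
  assumes A: "finite A" and r: "0 < r" "ereal r \<le> p"
  shows "lpn (ereal r) A f \<le> real (card A) powr (1 / r - invp p) * lpn p A f"
proof (cases "A = {}")
  case False
  define N where "N = real (card A)"
  have N: "0 < N"
    using False A by (simp add: N_def card_gt_0_iff)
  show ?thesis
  proof (cases p)
    case (real u)
    then have u: "r \<le> u" "0 < u"
      using r by auto
    have "(\<Sum>x\<in>A. \<bar>f x\<bar> powr r) powr (u / r) \<le> N powr (u / r - 1) * (\<Sum>x\<in>A. (\<bar>f x\<bar> powr r) powr (u / r))"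
      unfolding N_def using A r u by (intro powr_sum_le) auto
    then have "(\<Sum>x\<in>A. \<bar>f x\<bar> powr r) powr (u / r) \<le> N powr (u / r - 1) * (\<Sum>x\<in>A. \<bar>f x\<bar> powr u)"
      using r by (simp add: powr_powr)
    then have "((\<Sum>x\<in>A. \<bar>f x\<bar> powr r) powr (u / r)) powr (1 / u)
        \<le> (N powr (u / r - 1) * (\<Sum>x\<in>A. \<bar>f x\<bar> powr u)) powr (1 / u)"
      using u by (intro powr_mono2) auto
    moreover have "((\<Sum>x\<in>A. \<bar>f x\<bar> powr r) powr (u / r)) powr (1 / u) = lpn (ereal r) A f"
      using u by (simp add: powr_powr lpn_def)
    moreover have "(u / r - 1) * (1 / u) = 1 / r - invp p"
      using u r real by (simp add: invp_def field_simps)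
    then have "(N powr (u / r - 1) * (\<Sum>x\<in>A. \<bar>f x\<bar> powr u)) powr (1 / u)
        = N powr (1 / r - invp p) * lpn p A f"
      using real by (simp add: powr_mult sum_nonneg powr_powr lpn_def)
    ultimately show ?thesis
      by (simp add: N_def)
  next
    case PInf
    then have "lpn (ereal r) A f \<le> lpn p A f * N powr invp (ereal r)"
      unfolding N_def using A False r by (intro lpn_le abs_le_lpn) auto
    then show ?thesis
      using PInf by (simp add: invp_def N_def mult.commute)
  qed (use r in simp)
qed (simp add: lpn_def)

lemma lpn_1: "lpn (ereal 1) A f = (\<Sum>x\<in>A. \<bar>f x\<bar>)"
  by (simp add: lpn_def sum_nonneg)

text \<open>Write \<open>\<bar>f x\<bar>\<close> as the product of its powers \<open>r\<close> and
  \<open>1 - r\<close> and bound the second factor by the norm; the first factors sum to the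
  \<open>r\<close>-th power of the norm.\<close>

lemma sum_abs_le_lpn:
  assumes A: "finite A" and r: "0 < r" "r \<le> 1"
  shows "(\<Sum>x\<in>A. \<bar>f x\<bar>) \<le> lpn (ereal r) A f"
proof -
  define M where "M = lpn (ereal r) A f"
  have M: "0 \<le> M"
    unfolding M_def using A by (rule lpn_nonneg)
  have powr_M: "M powr r = (\<Sum>x\<in>A. \<bar>f x\<bar> powr r)"
    using r by (simp add: M_def lpn_def powr_powr sum_nonneg)
  have split: "u = u powr r * u powr (1 - r)" if "0 \<le> u" for u :: real
    using that by (simp flip: powr_add)
  have "(\<Sum>x\<in>A. \<bar>f x\<bar>) \<le> (\<Sum>x\<in>A. \<bar>f x\<bar> powr r * M powr (1 - r))"
  proof (rule sum_mono)
    fix x assume "x \<in> A"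
    then have "\<bar>f x\<bar> \<le> M"
      unfolding M_def using A r by (intro abs_le_lpn) auto
    then have "\<bar>f x\<bar> powr r * \<bar>f x\<bar> powr (1 - r) \<le> \<bar>f x\<bar> powr r * M powr (1 - r)"
      using r by (intro mult_left_mono powr_mono2) auto
    then show "\<bar>f x\<bar> \<le> \<bar>f x\<bar> powr r * M powr (1 - r)"
      using split[of "\<bar>f x\<bar>"] by simp
  qed
  also have "\<dots> = M"
    using split[OF M] by (simp add: powr_M flip: sum_distrib_right)
  finally show ?thesis
    by (simp add: M_def)
qed

section \<open>Dyadic budgets of functionals\<close>

lemma admissible_index_card_le:
  assumes "admissible_index d Nb"
  obtains D where "1 \<le> D" "\<And>j. real (card (Nb j)) \<le> D * 2 powr (real j * real d)"
proof -
  obtain C1 C2 J where C: "0 < C1" "C1 \<le> C2"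
    and card: "\<And>j. J \<le> j \<Longrightarrow> 2 powr (- real (j * d)) * real (card (Nb j)) \<le> C2"
    using assms unfolding admissible_index_def by blast
  \<comment> \<open>The finitely many levels below \<open>J\<close> are absorbed into the
    constant.\<close>
  define D where "D = 1 + C2 + (\<Sum>j<J. real (card (Nb j)))"
  have sum0: "0 \<le> (\<Sum>j<J. real (card (Nb j)))"
    by (intro sum_nonneg) auto
  have "real (card (Nb j)) \<le> D * 2 powr (real j * real d)" for j
  proof (cases "J \<le> j")
    case True
    then have "real (card (Nb j)) \<le> C2 * 2 powr (real j * real d)"
      using card[of j] by (simp add: powr_minus divide_simps mult.commute)
    also have "\<dots> \<le> D * 2 powr (real j * real d)"
      using sum0 by (intro mult_right_mono) (auto simp: D_def)
    finally show ?thesis .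
  next
    case False
    then have "real (card (Nb j)) \<le> (\<Sum>j<J. real (card (Nb j)))"
      by (intro member_le_sum) auto
    also have "\<dots> \<le> D * 1"
      using C by (simp add: D_def)
    also have "\<dots> \<le> D * 2 powr (real j * real d)"
      using C sum0 by (intro mult_left_mono) (auto simp: D_def ge_one_powr_ge_zero)
    finally show ?thesis .
  qed
  moreover have "1 \<le> D"
    using C sum0 by (simp add: D_def)
  ultimately show thesis
    using that by blast
qed

text \<open>For given \<open>n\<close> take the largest affordable \<open>k\<close>, or 0 if there
  is none; then \<open>2 powr (k * d)\<close> is at least a constant multiple of
  \<open>n\<close>.\<close>

lemma dyadic_rate_imp_rate:
  fixes W :: "nat \<Rightarrow> ennreal"
  assumes d: "1 \<le> d" and \<tau>: "0 < \<tau>" and C: "0 < C" "0 \<le> B"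
    and W: "\<And>k n. k = 0 \<or> C * 2 powr (real k * real d) \<le> real n \<Longrightarrow> W n \<le> ennreal (B * 2 powr (- real k * \<tau>))"
  shows "\<exists>c>0. \<forall>n::nat\<ge>1. W n \<le> ennreal (c * real n powr (- \<tau> / real d))"
proof -
  define e where "e = - \<tau> / real d"
  have e: "e < 0"
    using d \<tau> by (simp add: e_def)
  define C' where "C' = C * 2 powr real d"
  \<comment> \<open>The summand 1 keeps \<open>c\<close> positive when \<open>B = 0\<close>.\<close>
  define c where "c = (B + 1) * (1 / C') powr e"
  have C': "0 < C'"
    using C by (simp add: C'_def)
  have "W n \<le> ennreal (c * real n powr e)" if n: "1 \<le> n" for n :: nat
  proof -
    obtain k0 :: nat where k0: "real n / C < 2 powr (real k0 * real d)"
        "\<And>i. i < k0 \<Longrightarrow> 2 powr (real i * real d) \<le> real n / C"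
      using first_dyadic_level_above[OF d] by blast
    \<comment> \<open>For \<open>k0 = 0\<close> truncated subtraction gives \<open>k = 0\<close>,
      which the first alternative of the hypothesis covers for every \<open>n\<close>.\<close>
    define k where "k = k0 - 1"
    have "k = 0 \<or> C * 2 powr (real k * real d) \<le> real n"
      using k0(2)[of k] C by (cases "k0 = 0") (auto simp: k_def field_simps)
    then have W_le: "W n \<le> ennreal (B * 2 powr (- real k * \<tau>))"
      by (rule W)
    have "2 powr (real k0 * real d) \<le> 2 powr (real d + real k * real d)"
    proof (intro powr_mono)
      have "real k0 \<le> 1 + real k"
        by (simp add: k_def)
      then have "real k0 * real d \<le> (1 + real k) * real d"
        by (rule mult_right_mono) simp
      then show "real k0 * real d \<le> real d + real k * real d"
        by (simp add: distrib_right)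
    qed simp
    then have "real n / C < 2 powr real d * 2 powr (real k * real d)"
      using k0(1) by (simp add: powr_add)
    then have "real n / C' \<le> 2 powr (real k * real d)"
      using C by (simp add: C'_def field_simps)
    then have "(2 powr (real k * real d)) powr e \<le> (real n / C') powr e"
      using n C' e by (intro powr_mono2') auto
    moreover have "(2 powr (real k * real d)) powr e = 2 powr (- real k * \<tau>)"
      using d by (simp add: powr_powr e_def)
    moreover have "(real n / C') powr e = (1 / C') powr e * real n powr e"
      using C' by (simp flip: powr_mult)
    ultimately have le: "2 powr (- real k * \<tau>) \<le> (1 / C') powr e * real n powr e"
      by simp
    have "B * 2 powr (- real k * \<tau>) \<le> (B + 1) * ((1 / C') powr e * real n powr e)"
      using C(2) le by (intro mult_mono) auto
    then show ?thesis
      using W_le by (simp add: c_def mult.assoc) (meson ennreal_leI order_trans)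
  qed
  moreover have "0 < c"
    using C C' by (simp add: c_def)
  ultimately show ?thesis
    unfolding e_def by blast
qed

lemma exists_coordinate_functionals:
  assumes "finite A"
  shows "\<exists>c :: nat \<Rightarrow> 'a \<Rightarrow> real. \<forall>f. (\<forall>r<card A. (\<Sum>x\<in>A. c r x * f x) = 0) \<longrightarrow> (\<forall>x\<in>A. f x = 0)"
proof -
  obtain h where h: "bij_betw h {0..<card A} A"
    using ex_bij_betw_nat_finite[OF assms] by blast
  show ?thesis
  proof (intro exI[of _ "\<lambda>r x. if x = h r then 1 else 0"] allI impI ballI)
    fix f :: "'a \<Rightarrow> real" and x
    assume zero: "\<forall>r<card A. (\<Sum>x\<in>A. (if x = h r then 1 else 0) * f x) = 0" and x: "x \<in> A"
    have "x \<in> h ` {0..<card A}"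
      using h x by (simp add: bij_betw_def)
    then obtain r where r: "r < card A" "x = h r"
      by auto
    have "(\<Sum>y\<in>A. (if y = h r then 1 else 0) * f y) = (\<Sum>y\<in>A. if y = x then f y else 0)"
      using r by (intro sum.cong) auto
    also have "\<dots> = f x"
      using assms x by simp
    finally show "f x = 0"
      using zero r by simp
  qed
qed

text \<open>All coordinates of the levels below \<open>k\<close> are used up; level \<open>k + i\<close> receives a geometrically
  decreasing share of about \<open>2\<^sup>k\<^sup>d\<close> functionals. The factor \<open>1 / 2\<close> makes the case \<open>k = 0\<close> cost nothing.\<close>

lemma gelfand_width_upper_bound:
  assumes d: "1 \<le> d" and fin: "\<And>j. finite (Nb j)"
    and D: "1 \<le> D" "\<And>j. real (card (Nb j)) \<le> D * 2 powr (real j * real d)"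
    and pq: "0 < p" "0 < q" and \<tau>: "0 < \<tau>" and \<eta>: "0 \<le> \<eta>" "\<eta> < 1" and \<theta>: "0 \<le> \<theta>" "\<theta> < 1" and E: "0 \<le> E"
    and step: "\<And>k i. \<exists>c :: nat \<Rightarrow> idx \<Rightarrow> real. \<forall>f.
      (\<forall>r<nat \<lfloor>2 powr (real k * real d) * \<eta> ^ i / 2\<rfloor>. (\<Sum>x\<in>Nb (k + i). c r x * f x) = 0) \<longrightarrow>
      level_weight d \<sigma> p (k + i) * lpn p (Nb (k + i)) f \<le> 1 \<longrightarrow>
      (2 powr (real (k + i) * s) * lpn 2 (Nb (k + i)) f)\<^sup>2 \<le> E * 2 powr (- 2 * real k * \<tau>) * \<theta> ^ i"
  shows "\<exists>c>0. \<forall>n::nat\<ge>1. gelfand_width d Nb n \<sigma> p q s 2 2 \<le> ennreal (c * real n powr (- \<tau> / real d))"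
proof (rule dyadic_rate_imp_rate[OF d \<tau>])
  \<comment> \<open>The part \<open>D\<close> pays for all coordinates below level \<open>k\<close>,
    the geometric series for the shares from level \<open>k\<close> on.\<close>
  define C where "C = D + 1 / (1 - \<eta>)"
  define B where "B = sqrt (E / (1 - \<theta>))"
  show "0 < C"
    using D(1) \<eta> by (simp add: C_def add_pos_pos)
  show "0 \<le> B"
    using E \<theta> by (simp add: B_def)
  fix k n :: nat
  assume n: "k = 0 \<or> C * 2 powr (real k * real d) \<le> real n"
  define M where "M = 2 powr (real k * real d)"
  have M: "0 < M"
    by (simp add: M_def)
  define m where "m = (\<lambda>j. if j < k then card (Nb j) else nat \<lfloor>M * \<eta> ^ (j - k) / 2\<rfloor>)"
  define \<beta> where "\<beta> = (\<lambda>j. if j < k then 0 else E * 2 powr (- 2 * real k * \<tau>) * \<theta> ^ (j - k))"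
  have "\<exists>c :: nat \<Rightarrow> idx \<Rightarrow> real. \<forall>f. (\<forall>r<m j. (\<Sum>x\<in>Nb j. c r x * f x) = 0) \<longrightarrow>
      level_weight d \<sigma> p j * lpn p (Nb j) f \<le> 1 \<longrightarrow> (2 powr (real j * s) * lpn 2 (Nb j) f)\<^sup>2 \<le> \<beta> j" for j
  proof (cases "j < k")
    case True
    obtain c :: "nat \<Rightarrow> idx \<Rightarrow> real" where
      "\<forall>f. (\<forall>r<card (Nb j). (\<Sum>x\<in>Nb j. c r x * f x) = 0) \<longrightarrow> (\<forall>x\<in>Nb j. f x = 0)"
      using exists_coordinate_functionals[OF fin[of j]] by blast
    then show ?thesis
      using True by (intro exI[of _ c]) (auto simp: m_def \<beta>_def lpn_eq_0)
  next
    case False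
    then show ?thesis
      using step[of k "j - k"] by (simp add: m_def \<beta>_def M_def)
  qed
  then obtain c :: "nat \<Rightarrow> nat \<Rightarrow> idx \<Rightarrow> real" where
    c: "\<And>j f. (\<forall>r<m j. (\<Sum>x\<in>Nb j. c j r x * f x) = 0) \<Longrightarrow>
      level_weight d \<sigma> p j * lpn p (Nb j) f \<le> 1 \<Longrightarrow> (2 powr (real j * s) * lpn 2 (Nb j) f)\<^sup>2 \<le> \<beta> j"
    by metis
  \<comment> \<open>Beyond level \<open>k + i0\<close> the shares are less than 1 and round down to
    zero, so only finitely many functionals occur.\<close>
  obtain i0 where i0: "\<eta> ^ i0 < 1 / M"
    using real_arch_pow_inv[of "1 / M" \<eta>] M \<eta> by auto
  have m0: "m j = 0" if "k + i0 < j" for j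
  proof -
    have "\<eta> ^ (j - k) \<le> \<eta> ^ i0"
      using that \<eta> by (intro power_decreasing) auto
    then have "M * \<eta> ^ (j - k) \<le> M * \<eta> ^ i0"
      using M by (intro mult_left_mono) auto
    also have "\<dots> < 1"
      using i0 M by (simp add: pos_less_divide_eq mult.commute)
    finally have "M * \<eta> ^ (j - k) < 1" .
    moreover have "0 \<le> M * \<eta> ^ (j - k)"
      using M \<eta> by simp
    ultimately have "\<lfloor>M * \<eta> ^ (j - k) / 2\<rfloor> = 0"
      by (intro floor_unique) auto
    then show ?thesis
      using that by (simp add: m_def)
  qed
  have low: "(\<Sum>j<k. 2 powr (real j * real d)) \<le> M"
    unfolding M_def
  proof (induction k)
    case (Suc k)
    have "2 * 2 powr (real k * real d) = 2 powr (1 + real k * real d)"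
      by (simp add: powr_add)
    also have "\<dots> \<le> 2 powr (real (Suc k) * real d)"
      using d by (intro powr_mono) (auto simp: algebra_simps)
    finally show ?case
      using Suc by simp
  qed simp
  have "(\<Sum>j\<le>k + i0. m j) \<le> n"
  proof (cases "k = 0")
    case True
    have "\<eta> ^ j \<le> 1" for j
      using \<eta> by (simp add: power_le_one)
    \<comment> \<open>Without the halving, the share \<open>\<eta> ^ 0 = 1\<close> of level 0 would
      still cost one functional.\<close>
    then have "\<lfloor>\<eta> ^ j / 2\<rfloor> = 0" for j
      using \<eta> by (intro floor_unique) (auto intro: le_less_trans[of _ 1])
    then show ?thesis
      using True by (simp add: m_def M_def)
  next
    case False
    have "{..k + i0} = {..<k} \<union> (\<lambda>i. k + i) ` {..i0}"
    proof (intro set_eqI iffI)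
      fix j assume "j \<in> {..k + i0}"
      then show "j \<in> {..<k} \<union> (\<lambda>i. k + i) ` {..i0}"
        by (cases "j < k") (auto intro!: image_eqI[of _ _ "j - k"])
    qed auto
    then have "(\<Sum>j\<le>k + i0. real (m j)) = (\<Sum>j<k. real (m j)) + (\<Sum>j\<in>(\<lambda>i. k + i) ` {..i0}. real (m j))"
      by (simp only:) (subst sum.union_disjoint, auto)
    also have "(\<Sum>j\<in>(\<lambda>i. k + i) ` {..i0}. real (m j)) = (\<Sum>i\<le>i0. real (m (k + i)))"
      by (subst sum.reindex) (auto simp: inj_on_def)
    also have "(\<Sum>j<k. real (m j)) \<le> (\<Sum>j<k. D * 2 powr (real j * real d))"
      using D(2) by (intro sum_mono) (auto simp: m_def)
    also have "\<dots> \<le> D * M"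
      using low D(1) by (simp add: mult_left_mono flip: sum_distrib_left)
    also have "(\<Sum>i\<le>i0. real (m (k + i))) \<le> (\<Sum>i\<le>i0. M * \<eta> ^ i)"
    proof (rule sum_mono)
      fix i
      have "0 \<le> M * \<eta> ^ i"
        using M \<eta> by simp
      then show "real (m (k + i)) \<le> M * \<eta> ^ i"
        by (simp add: m_def) linarith
    qed
    also have "\<dots> \<le> M * (1 / (1 - \<eta>))"
    proof -
      have "(\<Sum>i\<le>i0. \<eta> ^ i) \<le> (\<Sum>i. \<eta> ^ i)"
        using \<eta> by (intro sum_le_suminf summable_geometric) auto
      also have "\<dots> = 1 / (1 - \<eta>)"
        using \<eta> by (intro suminf_geometric) auto
      finally show ?thesis
        unfolding sum_distrib_left[symmetric] using M by (intro mult_left_mono) auto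
    qed
    finally have "(\<Sum>j\<le>k + i0. real (m j)) \<le> C * M"
      by (simp add: C_def algebra_simps)
    also have "\<dots> \<le> real n"
      using n False by (simp add: M_def)
    finally show ?thesis
      by (simp flip: of_nat_sum)
  qed
  moreover have "\<beta> sums (E * 2 powr (- 2 * real k * \<tau>) * (1 / (1 - \<theta>)) + (\<Sum>j<k. \<beta> j))"
  proof (rule sums_iff_shift[THEN iffD1])
    show "(\<lambda>i. \<beta> (i + k)) sums (E * 2 powr (- 2 * real k * \<tau>) * (1 / (1 - \<theta>)))"
      using sums_mult[OF geometric_sums[of \<theta>], of "E * 2 powr (- 2 * real k * \<tau>)"] \<theta> by (simp add: \<beta>_def)
  qed
  then have "\<beta> sums (B * 2 powr (- real k * \<tau>))\<^sup>2"
    using E \<theta> by (simp add: \<beta>_def B_def power_mult_distrib powr_power mult.commute mult.left_commute)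
  moreover have "0 \<le> B * 2 powr (- real k * \<tau>)"
    using \<open>0 \<le> B\<close> by simp
  ultimately show "gelfand_width d Nb n \<sigma> p q s 2 2 \<le> ennreal (B * 2 powr (- real k * \<tau>))"
    by (intro gelfand_width_le_levels[OF fin pq m0 _ c]) (auto simp: sums_iff)
qed

text \<open>Trades the logarithm of the kernel inequality for a small power, which geometric decay
  can absorb.\<close>

lemma ln_le_powr:
  fixes x \<delta> :: real
  assumes "0 < x" "0 < \<delta>"
  shows "ln x \<le> x powr \<delta> / \<delta>"
proof -
  have "ln (x powr \<delta>) \<le> x powr \<delta> - 1"
    using assms by (intro ln_le_minus_one) auto
  then show ?thesis
    using assms by (simp add: ln_powr field_simps)
qed

text \<open>On level \<open>k + i\<close> the kernel inequality with about
  \<open>2 powr (k * d - i * \<epsilon>)\<close> functionals turns the l1-bound into a squared error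
  of order \<open>2 powr (- 2 * k * \<tau>)\<close> times a factor decaying geometrically in
  \<open>i\<close>. The condition on \<open>\<tau>\<close> is what makes this decay
  possible.\<close>

lemma gelfand_width_upper_bound_l1:
  assumes d: "1 \<le> d" and fin: "\<And>j. finite (Nb j)"
    and D: "1 \<le> D" "\<And>j. real (card (Nb j)) \<le> D * 2 powr (real j * real d)"
    and pq: "0 < p" "0 < q" and \<tau>: "real d / 2 < \<tau>" and B: "0 \<le> B"
    and l1: "\<And>j f. level_weight d \<sigma> p j * lpn p (Nb j) f \<le> 1 \<Longrightarrow>
      (\<Sum>x\<in>Nb j. \<bar>f x\<bar>) \<le> B * 2 powr (- real j * (s + \<tau> - real d / 2))"
  shows "\<exists>c>0. \<forall>n::nat\<ge>1. gelfand_width d Nb n \<sigma> p q s 2 2 \<le> ennreal (c * real n powr (- \<tau> / real d))"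
proof -
  define \<gamma> where "\<gamma> = 2 * \<tau> - real d"
  have \<gamma>: "0 < \<gamma>"
    using \<tau> by (simp add: \<gamma>_def)
  \<comment> \<open>The l1-radii give a decay exponent \<open>\<gamma>\<close> per level. One
    quarter is spent on the shrinking shares, one quarter on the logarithm, and half remains in
    \<open>\<theta>\<close>.\<close>
  define \<epsilon> where "\<epsilon> = \<gamma> / 4"
  \<comment> \<open>The ratio \<open>K / \<mu>\<close> grows like
    \<open>2 powr (i * (d + \<epsilon>))\<close>; its power \<open>\<delta>\<close> then grows with
    exponent \<open>\<gamma> / 4\<close>.\<close>
  define \<delta> where "\<delta> = \<gamma> / (4 * (real d + \<epsilon>))"
  have \<epsilon>: "0 < \<epsilon>"
    using \<gamma> by (simp add: \<epsilon>_def)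
  then have \<delta>: "0 < \<delta>" "(real d + \<epsilon>) * \<delta> = \<gamma> / 4"
    using \<gamma> by (auto simp: \<delta>_def field_simps add_nonneg_pos)
  define \<eta> where "\<eta> = 2 powr (- \<epsilon>)"
  define \<theta> where "\<theta> = 2 powr (- (\<gamma> / 2))"
  \<comment> \<open>Both 4800 and 160 are twice the constants 2400 and 80 of the kernel inequality,
    because \<open>\<mu>\<close> contains the factor 1/2.\<close>
  define E where "E = 4800 * B\<^sup>2 * ((160 * D) powr \<delta> / \<delta>)"
  have two_powr_less_1: "(2 :: real) powr (- u) < 1" if "0 < u" for u :: real
    using powr_less_mono[of "- u" 0 "2 :: real"] that by simp
  show ?thesis
  proof (rule gelfand_width_upper_bound[OF d fin D pq, where \<eta> = \<eta> and \<theta> = \<theta> and E = E])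
    show "0 < \<tau>"
      using \<tau> by (meson le_less_trans of_nat_0_le_iff divide_nonneg_pos zero_less_numeral)
    show "0 \<le> \<eta>" "\<eta> < 1" "0 \<le> \<theta>" "\<theta> < 1"
      using \<epsilon> \<gamma> by (simp_all add: \<eta>_def \<theta>_def two_powr_less_1)
    show "0 \<le> E"
      using \<delta> by (simp add: E_def)
    fix k i :: nat
    define j where "j = k + i"
    define \<mu> where "\<mu> = 2 powr (real k * real d) * \<eta> ^ i / 2"
    define K where "K = D * 2 powr (real j * real d)"
    have \<eta>i: "\<eta> ^ i = 2 powr (- (real i * \<epsilon>))"
      by (simp add: \<eta>_def powr_power mult.commute)
    have \<mu>_eq: "\<mu> = 2 powr (real k * real d - real i * \<epsilon>) / 2"
      by (simp add: \<mu>_def \<eta>i flip: powr_add)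
    have \<mu>: "0 < \<mu>"
      by (simp add: \<mu>_eq)
    have "\<mu> \<le> 2 powr (real k * real d - real i * \<epsilon>)"
      by (simp add: \<mu>_eq)
    also have "\<dots> \<le> 2 powr (real j * real d)"
    proof (intro powr_mono)
      have "real k * real d \<le> real j * real d"
        by (intro mult_right_mono) (auto simp: j_def)
      moreover have "0 \<le> real i * \<epsilon>"
        using \<epsilon> by simp
      ultimately show "real k * real d - real i * \<epsilon> \<le> real j * real d"
        by linarith
    qed simp
    also have "\<dots> \<le> K"
      using D(1) by (simp add: K_def)
    finally have \<mu>K: "\<mu> \<le> K" .
    obtain c :: "nat \<Rightarrow> idx \<Rightarrow> real" where
      c: "\<forall>x. (\<forall>r<nat \<lfloor>\<mu>\<rfloor>. (\<Sum>i\<in>Nb j. c r i * x i) = 0) \<longrightarrow>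
        (\<Sum>i\<in>Nb j. (x i)\<^sup>2) \<le> 2400 * ln (80 * K / \<mu>) / \<mu> * (\<Sum>i\<in>Nb j. \<bar>x i\<bar>)\<^sup>2"
      using kernel_l2_le_l1[OF fin _ \<mu> \<mu>K, of j] D(2)[of j] unfolding K_def by blast
    have "80 * K / \<mu> = 160 * D * 2 powr (real i * (real d + \<epsilon>))"
    proof -
      have "2 powr (real j * real d) = 2 powr (real k * real d - real i * \<epsilon>) * 2 powr (real i * (real d + \<epsilon>))"
        by (simp add: j_def algebra_simps flip: powr_add)
      then show ?thesis
        by (simp add: K_def \<mu>_eq)
    qed
    moreover have "0 < 80 * K / \<mu>"
      using \<mu> \<mu>K by simp
    ultimately have "ln (80 * K / \<mu>) \<le> (160 * D * 2 powr (real i * (real d + \<epsilon>))) powr \<delta> / \<delta>"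
      using ln_le_powr \<delta>(1) by metis
    also have "\<dots> = (160 * D) powr \<delta> * 2 powr (real i * ((real d + \<epsilon>) * \<delta>)) / \<delta>"
      using D(1) by (simp add: powr_mult powr_powr mult.assoc)
    finally have ln_le: "ln (80 * K / \<mu>) \<le> (160 * D) powr \<delta> / \<delta> * 2 powr (real i * \<gamma> / 4)"
      unfolding \<delta>(2) by simp
    have "(2 powr (real j * s) * lpn 2 (Nb j) f)\<^sup>2 \<le> E * 2 powr (- 2 * real k * \<tau>) * \<theta> ^ i"
      if ker: "\<forall>r<nat \<lfloor>\<mu>\<rfloor>. (\<Sum>x\<in>Nb j. c r x * f x) = 0"
        and f: "level_weight d \<sigma> p j * lpn p (Nb j) f \<le> 1" for f
    proof -
      define u where "u = - real j * (s + \<tau> - real d / 2)"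
      have "(\<Sum>x\<in>Nb j. \<bar>f x\<bar>)\<^sup>2 \<le> (B * 2 powr u)\<^sup>2"
        unfolding u_def using l1[OF f] by (intro power_mono sum_nonneg) auto
      also have "\<dots> = B\<^sup>2 * 2 powr (2 * u)"
        by (simp add: power_mult_distrib powr_power)
      finally have l1_f: "(\<Sum>x\<in>Nb j. \<bar>f x\<bar>)\<^sup>2 \<le> B\<^sup>2 * 2 powr (2 * u)" .
      have "(\<Sum>x\<in>Nb j. (f x)\<^sup>2) \<le> 2400 * ln (80 * K / \<mu>) / \<mu> * (\<Sum>x\<in>Nb j. \<bar>f x\<bar>)\<^sup>2"
        using c ker by blast
      also have "\<dots> \<le> 2400 * ((160 * D) powr \<delta> / \<delta> * 2 powr (real i * \<gamma> / 4)) / \<mu> * (B\<^sup>2 * 2 powr (2 * u))"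
        using l1_f \<mu> \<delta> ln_le by (intro mult_mono[of "_ / _"] divide_right_mono mult_left_mono) auto
      also have "\<dots> = E * (2 powr (real i * \<gamma> / 4) * 2 powr (2 * u) / 2 powr (real k * real d - real i * \<epsilon>))"
        by (simp add: E_def \<mu>_eq)
      also have "\<dots> = E * 2 powr (real i * \<gamma> / 4 + 2 * u - (real k * real d - real i * \<epsilon>))"
        by (simp add: powr_add powr_diff)
      finally have "(\<Sum>x\<in>Nb j. (f x)\<^sup>2) \<le> E * 2 powr (real i * \<gamma> / 4 + 2 * u - (real k * real d - real i * \<epsilon>))" .
      then have "2 powr (2 * (real j * s)) * (\<Sum>x\<in>Nb j. (f x)\<^sup>2)
          \<le> 2 powr (2 * (real j * s)) * (E * 2 powr (real i * \<gamma> / 4 + 2 * u - (real k * real d - real i * \<epsilon>)))"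
        by (intro mult_left_mono) auto
      also have "\<dots> = E * 2 powr (2 * (real j * s) + (real i * \<gamma> / 4 + 2 * u - (real k * real d - real i * \<epsilon>)))"
        by (simp only: powr_add mult_ac)
      also have "2 * (real j * s) + (real i * \<gamma> / 4 + 2 * u - (real k * real d - real i * \<epsilon>))
          = - 2 * real k * \<tau> + - (\<gamma> / 2) * real i"
        by (simp add: u_def j_def \<epsilon>_def \<gamma>_def field_simps)
      also have "2 powr (- 2 * real k * \<tau> + - (\<gamma> / 2) * real i) = 2 powr (- 2 * real k * \<tau>) * \<theta> ^ i"
        unfolding powr_add \<theta>_def by (simp add: powr_power mult.commute)
      finally show ?thesis
        unfolding lpn_2 by (simp add: power_mult_distrib powr_power sum_nonneg mult.assoc)
    qed
    then show "\<exists>c :: nat \<Rightarrow> idx \<Rightarrow> real. \<forall>f.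
      (\<forall>r<nat \<lfloor>2 powr (real k * real d) * \<eta> ^ i / 2\<rfloor>. (\<Sum>x\<in>Nb (k + i). c r x * f x) = 0) \<longrightarrow>
      level_weight d \<sigma> p (k + i) * lpn p (Nb (k + i)) f \<le> 1 \<longrightarrow>
      (2 powr (real (k + i) * s) * lpn 2 (Nb (k + i)) f)\<^sup>2 \<le> E * 2 powr (- 2 * real k * \<tau>) * \<theta> ^ i"
      unfolding \<mu>_def[symmetric] j_def[symmetric] by blast
  qed
qed

section \<open>The three ranges of \<open>p\<close>\<close>

lemma lpn_le_level_weight:
  assumes "level_weight d \<sigma> p j * lpn p A f \<le> 1"
  shows "lpn p A f \<le> 2 powr (- (real j * (\<sigma> + real d * (1 / 2 - invp p))))"
proof -
  have "lpn p A f \<le> 1 / level_weight d \<sigma> p j"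
    using assms by (simp add: pos_le_divide_eq mult.commute)
  then show ?thesis
    by (simp add: level_weight_def powr_minus_divide)
qed

lemma card_powr_lpn_le:
  assumes D: "1 \<le> D" "real (card A) \<le> D * 2 powr (real j * real d)" and e: "0 \<le> e" and A: "finite A"
    and f: "level_weight d \<sigma> p j * lpn p A f \<le> 1"
  shows "real (card A) powr e * lpn p A f
    \<le> D powr e * 2 powr (real j * real d * e - real j * (\<sigma> + real d * (1 / 2 - invp p)))"
proof -
  have "real (card A) powr e \<le> (D * 2 powr (real j * real d)) powr e"
    using D e by (intro powr_mono2) auto
  also have "\<dots> = D powr e * 2 powr (real j * real d * e)"
    using D by (simp add: powr_mult powr_powr)
  finally have "real (card A) powr e * lpn p A f
      \<le> (D powr e * 2 powr (real j * real d * e)) * 2 powr (- (real j * (\<sigma> + real d * (1 / 2 - invp p))))"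
    using lpn_le_level_weight[OF f] lpn_nonneg[OF A] by (intro mult_mono) auto
  then show ?thesis
    by (simp add: powr_diff powr_minus_divide)
qed

text \<open>Hoelder's inequality puts the unit ball of each level into an l1-ball; the dependence on
  \<open>p\<close> cancels in the exponent of its radius.\<close>

lemma gelfand_width_upper_bound_p_between_1_2:
  assumes d: "1 \<le> d" and adm: "admissible_index d Nb" and "1 \<le> p" "0 < q" and t: "real d / 2 < t"
  shows "\<exists>c>0. \<forall>n::nat\<ge>1. gelfand_width d Nb n (s + t) p q s 2 2 \<le> ennreal (c * real n powr (- t / real d))"
proof -
  have fin: "finite (Nb j)" for j
    using adm by (simp add: admissible_index_def)
  obtain D where D: "1 \<le> D" "\<And>j. real (card (Nb j)) \<le> D * 2 powr (real j * real d)"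
    using admissible_index_card_le[OF adm] by blast
  have p: "0 < p"
    using \<open>1 \<le> p\<close> by (cases p) auto
  have invp: "invp p \<le> 1"
    using \<open>1 \<le> p\<close> by (cases p) (auto simp: invp_def)
  show ?thesis
  proof (rule gelfand_width_upper_bound_l1[OF d fin D p \<open>0 < q\<close> t, where B = "D powr (1 - invp p)"])
    fix j f
    assume f: "level_weight d (s + t) p j * lpn p (Nb j) f \<le> 1"
    have "(\<Sum>x\<in>Nb j. \<bar>f x\<bar>) \<le> real (card (Nb j)) powr (1 - invp p) * lpn p (Nb j) f"
      using lpn_le_lpn[OF fin, of 1 p j f] \<open>1 \<le> p\<close> unfolding lpn_1 by (simp add: one_ereal_def)
    also have "\<dots> \<le> D powr (1 - invp p)
        * 2 powr (real j * real d * (1 - invp p) - real j * (s + t + real d * (1 / 2 - invp p)))"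
      using invp by (intro card_powr_lpn_le D fin f) auto
    also have "real j * real d * (1 - invp p) - real j * (s + t + real d * (1 / 2 - invp p))
        = - real j * (s + t - real d / 2)"
      by (simp add: field_simps)
    finally show "(\<Sum>x\<in>Nb j. \<bar>f x\<bar>) \<le> D powr (1 - invp p) * 2 powr (- real j * (s + t - real d / 2))" .
  qed simp
qed

text \<open>For \<open>r < 1\<close> the l1-norm is bounded by the \<open>r\<close>-norm with
  constant 1, which lowers the effective smoothness from \<open>t\<close> to
  \<open>\<tau> = t + d - d / r\<close>. The hypothesis on \<open>t\<close> is exactly
  \<open>\<tau> > d / 2\<close>.\<close>

lemma gelfand_width_upper_bound_p_less_1:
  fixes r :: real
  assumes d: "1 \<le> d" and adm: "admissible_index d Nb" and r: "0 < r" "r < 1" and "0 < q"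
    and t: "real d * (1 / r - 1 / 2) < t"
  shows "\<exists>c>0. \<forall>n::nat\<ge>1. gelfand_width d Nb n (s + t) (ereal r) q s 2 2
    \<le> ennreal (c * real n powr (- t / real d - 1 + 1 / r))"
proof -
  have fin: "finite (Nb j)" for j
    using adm by (simp add: admissible_index_def)
  obtain D where D: "1 \<le> D" "\<And>j. real (card (Nb j)) \<le> D * 2 powr (real j * real d)"
    using admissible_index_card_le[OF adm] by blast
  define \<tau> where "\<tau> = t + real d - real d / r"
  have \<tau>: "real d / 2 < \<tau>"
    using t by (simp add: \<tau>_def algebra_simps)
  have "\<exists>c>0. \<forall>n::nat\<ge>1. gelfand_width d Nb n (s + t) (ereal r) q s 2 2
    \<le> ennreal (c * real n powr (- \<tau> / real d))"
  proof (rule gelfand_width_upper_bound_l1[OF d fin D _ \<open>0 < q\<close> \<tau>, where B = 1])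
    fix j f
    assume f: "level_weight d (s + t) (ereal r) j * lpn (ereal r) (Nb j) f \<le> 1"
    have "(\<Sum>x\<in>Nb j. \<bar>f x\<bar>) \<le> lpn (ereal r) (Nb j) f"
      using r by (intro sum_abs_le_lpn fin) auto
    also have "\<dots> \<le> 2 powr (- (real j * (s + t + real d * (1 / 2 - invp (ereal r)))))"
      by (rule lpn_le_level_weight[OF f])
    also have "- (real j * (s + t + real d * (1 / 2 - invp (ereal r)))) = - real j * (s + \<tau> - real d / 2)"
      by (simp add: \<tau>_def invp_def field_simps)
    finally show "(\<Sum>x\<in>Nb j. \<bar>f x\<bar>) \<le> 1 * 2 powr (- real j * (s + \<tau> - real d / 2))"
      by simp
  qed (use r in auto)
  moreover have "- \<tau> / real d = - t / real d - 1 + 1 / r"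
    using d by (simp add: \<tau>_def diff_divide_distrib add_divide_distrib)
  ultimately show ?thesis
    by simp
qed

text \<open>Hoelder's inequality alone bounds the error on level \<open>j\<close> by a constant
  times \<open>2 powr (- j * t)\<close>, so discarding all levels from \<open>k\<close> on is good
  enough.\<close>

lemma gelfand_width_upper_bound_p_ge_2:
  assumes d: "1 \<le> d" and adm: "admissible_index d Nb" and "2 \<le> p" "0 < q" and t: "0 < t"
  shows "\<exists>c>0. \<forall>n::nat\<ge>1. gelfand_width d Nb n (s + t) p q s 2 2 \<le> ennreal (c * real n powr (- t / real d))"
proof -
  have fin: "finite (Nb j)" for j
    using adm by (simp add: admissible_index_def)
  obtain D where D: "1 \<le> D" "\<And>j. real (card (Nb j)) \<le> D * 2 powr (real j * real d)"
    using admissible_index_card_le[OF adm] by blast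
  have p: "0 < p"
    using \<open>2 \<le> p\<close> by (cases p) auto
  define e where "e = 1 / 2 - invp p"
  have e: "0 \<le> e"
    using \<open>2 \<le> p\<close> by (cases p) (auto simp: invp_def e_def field_simps)
  have level: "(2 powr (real j * s) * lpn 2 (Nb j) f)\<^sup>2 \<le> (D powr e)\<^sup>2 * 2 powr (- 2 * real j * t)"
    if f: "level_weight d (s + t) p j * lpn p (Nb j) f \<le> 1" for j f
  proof -
    have "lpn 2 (Nb j) f \<le> real (card (Nb j)) powr e * lpn p (Nb j) f"
      using lpn_le_lpn[OF fin, of 2 p j f] \<open>2 \<le> p\<close> by (simp add: e_def)
    also have "\<dots> \<le> D powr e * 2 powr (real j * real d * e - real j * (s + t + real d * (1 / 2 - invp p)))"
      using e by (intro card_powr_lpn_le D fin f)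
    also have "real j * real d * e - real j * (s + t + real d * (1 / 2 - invp p)) = - real j * s - real j * t"
      by (simp add: e_def algebra_simps)
    finally have "2 powr (real j * s) * lpn 2 (Nb j) f \<le> 2 powr (real j * s) * (D powr e * 2 powr (- real j * s - real j * t))"
      by (intro mult_left_mono) auto
    also have "\<dots> = D powr e * 2 powr (- real j * t)"
      by (simp add: powr_diff powr_minus_divide)
    finally have "(2 powr (real j * s) * lpn 2 (Nb j) f)\<^sup>2 \<le> (D powr e * 2 powr (- real j * t))\<^sup>2"
      using lpn_nonneg[OF fin] by (intro power_mono) auto
    then show ?thesis
      by (simp add: power_mult_distrib powr_power mult_ac)
  qed
  define \<theta> where "\<theta> = 2 powr (- 2 * t)"
  show ?thesis
  \<comment> \<open>With \<open>\<eta> = 0\<close> the levels above \<open>k\<close> get no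
    functionals. Level \<open>k\<close> keeps a share because \<open>0 ^ 0 = 1\<close>; its
    coefficients may be arbitrary, as the level bound holds for every \<open>f\<close> in the
    ball.\<close>
  proof (rule gelfand_width_upper_bound[OF d fin D p \<open>0 < q\<close> t, where \<eta> = 0 and \<theta> = \<theta> and E = "(D powr e)\<^sup>2"])
    show "0 \<le> \<theta>" "\<theta> < 1"
      using powr_less_mono[of "- 2 * t" 0 "2 :: real"] t by (simp_all add: \<theta>_def)
    fix k i :: nat
    have "2 powr (- 2 * real (k + i) * t) = 2 powr (- 2 * real k * t) * \<theta> ^ i"
      by (simp add: \<theta>_def powr_power algebra_simps flip: powr_add)
    then show "\<exists>c :: nat \<Rightarrow> idx \<Rightarrow> real. \<forall>f.
      (\<forall>r<nat \<lfloor>2 powr (real k * real d) * 0 ^ i / 2\<rfloor>. (\<Sum>x\<in>Nb (k + i). c r x * f x) = 0) \<longrightarrow>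
      level_weight d (s + t) p (k + i) * lpn p (Nb (k + i)) f \<le> 1 \<longrightarrow>
      (2 powr (real (k + i) * s) * lpn 2 (Nb (k + i)) f)\<^sup>2 \<le> (D powr e)\<^sup>2 * 2 powr (- 2 * real k * t) * \<theta> ^ i"
      using level[of "k + i"] by (simp add: mult.assoc)
  qed auto
qed

text \<open>A single lower bound serves all three ranges, and each range supplies its own upper
  bound. In the first and third range, positivity of \<open>t\<close> follows from the lower limit
  imposed on it.\<close>

theorem theorem8:
  fixes d :: nat and Nb :: "nat \<Rightarrow> idx set" and s t :: real and p q :: ereal
  assumes "d \<ge> 1" and "admissible_index d Nb" and "0 < q"
  shows
   "(1 \<le> p \<and> p < 2 \<and> t > real d / 2 \<longrightarrow>
      (\<exists>c1 c2. 0 < c1 \<and> 0 < c2 \<and> (\<forall>n::nat\<ge>1.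
         ennreal (c1 * real n powr (- t / real d)) \<le> gelfand_width d Nb n (s + t) p q s 2 2 \<and>
         gelfand_width d Nb n (s + t) p q s 2 2 \<le> ennreal (c2 * real n powr (- t / real d))))) \<and>
    (2 < p \<and> t > 0 \<longrightarrow>
      (\<exists>c1 c2. 0 < c1 \<and> 0 < c2 \<and> (\<forall>n::nat\<ge>1.
         ennreal (c1 * real n powr (- t / real d)) \<le> gelfand_width d Nb n (s + t) p q s 2 2 \<and>
         gelfand_width d Nb n (s + t) p q s 2 2 \<le> ennreal (c2 * real n powr (- t / real d))))) \<and>
    (0 < p \<and> p < 1 \<and> t > real d * (1 / real_of_ereal p - 1 / 2) \<longrightarrow>
      (\<exists>c1 c2. 0 < c1 \<and> 0 < c2 \<and> (\<forall>n::nat\<ge>1.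
         ennreal (c1 * real n powr (- t / real d)) \<le> gelfand_width d Nb n (s + t) p q s 2 2 \<and>
         gelfand_width d Nb n (s + t) p q s 2 2 \<le>
           ennreal (c2 * real n powr (- t / real d - 1 + 1 / real_of_ereal p)))))"
proof (intro conjI impI)
  assume p: "1 \<le> p \<and> p < 2 \<and> t > real d / 2"
  then have "0 < p" "0 < t"
    by (cases p; simp) (use p in \<open>auto intro: le_less_trans[of 0 "real d / 2"]\<close>)
  then show "\<exists>c1 c2. 0 < c1 \<and> 0 < c2 \<and> (\<forall>n::nat\<ge>1.
      ennreal (c1 * real n powr (- t / real d)) \<le> gelfand_width d Nb n (s + t) p q s 2 2 \<and>
      gelfand_width d Nb n (s + t) p q s 2 2 \<le> ennreal (c2 * real n powr (- t / real d)))"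
    using gelfand_width_lower_bound[OF assms(1,2) _ assms(3), of p t s]
      gelfand_width_upper_bound_p_between_1_2[OF assms(1,2) _ assms(3), of p t s] p by blast
next
  assume p: "2 < p \<and> t > 0"
  then have "0 < p" "2 \<le> p"
    by (auto intro: less_trans[of 0 "2 :: ereal"])
  then show "\<exists>c1 c2. 0 < c1 \<and> 0 < c2 \<and> (\<forall>n::nat\<ge>1.
      ennreal (c1 * real n powr (- t / real d)) \<le> gelfand_width d Nb n (s + t) p q s 2 2 \<and>
      gelfand_width d Nb n (s + t) p q s 2 2 \<le> ennreal (c2 * real n powr (- t / real d)))"
    using gelfand_width_lower_bound[OF assms(1,2) _ assms(3), of p t s]
      gelfand_width_upper_bound_p_ge_2[OF assms(1,2) _ assms(3), of p t s] p by blast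
next
  assume p: "0 < p \<and> p < 1 \<and> t > real d * (1 / real_of_ereal p - 1 / 2)"
  obtain r where r: "p = ereal r" "0 < r" "r < 1"
    using p by (cases p) auto
  have "0 \<le> real d * (1 / r - 1 / 2)"
    using r by (intro mult_nonneg_nonneg) (auto simp: field_simps)
  moreover have "real d * (1 / r - 1 / 2) < t"
    using p r by simp
  ultimately have "0 < t"
    by linarith
  then show "\<exists>c1 c2. 0 < c1 \<and> 0 < c2 \<and> (\<forall>n::nat\<ge>1.
      ennreal (c1 * real n powr (- t / real d)) \<le> gelfand_width d Nb n (s + t) p q s 2 2 \<and>
      gelfand_width d Nb n (s + t) p q s 2 2 \<le>
        ennreal (c2 * real n powr (- t / real d - 1 + 1 / real_of_ereal p)))"
    using gelfand_width_lower_bound[OF assms(1,2) _ assms(3), of p t s]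
      gelfand_width_upper_bound_p_less_1[OF assms(1,2) r(2,3) assms(3), of t s] p r by auto
qed

end
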